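(* For every $m\in\mathbb{Q}_{>0}$ there exists a unique $\mathbb{Q}[\mu]$-linear map $\zeta^{\mu,T}_{*,m}:\mathbb{Q}[\mu]\langle Y\rangle\to\mathcal{Z}^{\mu}[T]$ such that (i) $\zeta^{\mu,T}_{*,m}(w)=\zeta^{\mu}_{*}(w)$ for all $w\in\mathbb{Q}[\mu]\langle Y\rangle^0$; (ii) $\zeta^{\mu,T}_{*,m}(y_{1,m})=T$; (iii) $\zeta^{\mu,T}_{*,m}(v\ast_\mu w)=\zeta^{\mu,T}_{*,m}(v)\cdot\zeta^{\mu,T}_{*,m}(w)$ for all $v,w\in\mathbb{Q}[\mu]\langle Y\rangle$.
   Context: Fix $\mu\in\mathbb{C}$ with $\mathrm{Re}(\mu)>0$; $\mathbb{Q}[\mu]\subset\mathbb{C}$ is the ring generated by $\mu$ over $\mathbb{Q}$. A bi-index $(\mathbf{k};\mathbf{m})=(k_1,\dots,k_r;m_1,\dots,m_r)\in\mathbb{N}^r\times\mathbb{Q}^r$ is positive if all $m_i>0$, admissible if positive and $k_r>1$ (the empty bi-index is admissible). For admissible ones $\zeta^{\mu}(\mathbf{k};\mathbf{m})=\sum_{0\le n_1\le\cdots\le n_r}\mu^r\prod_i(n_i\mu+m_i)^{-k_i}$, $\zeta^\mu(\emptyset)=1$. A special triple $(\mathbf{k};\mathbf{m};\tilde{\mathbf{m}})$: $\mathbf{k}=(k_1,\dots,k_{r-1},1)$, $\mathbf{m}=(m_1,\dots,m_r)$, $\tilde{\mathbf{m}}=(m_1,\dots,m_{r-1},\tilde m_r)$,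 entries in $\mathbb{Q}_{>0}$, $m_r\ne\tilde m_r$; $\mathcal{D}^{\mu}(\mathbf{k};\mathbf{m};\tilde{\mathbf{m}})=(\tilde m_r-m_r)\sum_{0\le n_1\le\cdots\le n_r}\frac{\mu^r}{\prod_{i<r}(n_i\mu+m_i)^{k_i}(n_r\mu+m_r)(n_r\mu+\tilde m_r)}$. $\mathcal{Z}^\mu\subset\mathbb{C}$ is the $\mathbb{Q}[\mu]$-span of $1$, all $\zeta^\mu(\mathbf{k};\mathbf{m})$ (admissible) and all $\mathcal{D}^\mu$ of special triples; it is a ring. Let $Y=\{y_{k,m}:k\in\mathbb{N},m\in\mathbb{Q}_{>0}\}$ and $\mathbb{Q}[\mu]\langle Y\rangle$ the free noncommutative $\mathbb{Q}[\mu]$-algebra on $Y$ (product = concatenation, empty word $1$); write $y_{\mathbf{k};\mathbf{m}}=y_{k_1,m_1}\cdots y_{k_r,m_r}$. On the span $\mathbb{Q}[\mu]Y$ of letters define the bilinear product $\odot$ by $y_{k_1,m}\odot y_{k_2,m}=y_{k_1+k_2,m}$ and, for $m_1\ne m_2$, $y_{k_1,m_1}\odot y_{k_2,m_2}=\sum_{i=1}^{k_1}a_iy_{i,m_1}+\sum_{j=1}^{k_2}b_jy_{j,m_2}$ where $\frac{1}{(x+m_1)^{k_1}(x+m_2)^{k_2}}=\sum_{i=1}^{k_1}\frac{a_i}{(x+m_1)^i}+\sum_{j=1}^{k_2}\frac{b_j}{(x+m_2)^j}$. The $\mu$-stuffle product $\ast_\mu$ is the $\mathbb{Q}[\mu]$-bilinear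 product with $1\ast_\mu w=w\ast_\mu1=w$ and $ux\ast_\mu vy=(u\ast_\mu vy)x+(ux\ast_\mu v)y-\mu(u\ast_\mu v)(x\odot y)$ for letters $x,y$ and words $u,v$. Admissible words are $1$ and $y_{\mathbf{k};\mathbf{m}}$ with $(\mathbf{k};\mathbf{m})$ admissible; quasi-admissible words are $y_{\mathbf{k};\mathbf{m}}-y_{\mathbf{k};\tilde{\mathbf{m}}}$ for special triples; $\mathbb{Q}[\mu]\langle Y\rangle^0$ is their $\mathbb{Q}[\mu]$-span. For $M\ge0$ let $\zeta^\mu_{*,M}$ be the $\mathbb{Q}[\mu]$-linear map sending $y_{\mathbf{k};\mathbf{m}}$ to the truncated sum $\sum_{0\le n_1\le\cdots\le n_r\le M}\mu^r\prod_i(n_i\mu+m_i)^{-k_i}$; then $\zeta^\mu_*:\mathbb{Q}[\mu]\langle Y\rangle^0\to\mathcal{Z}^\mu$, $\zeta^\mu_*(w)=\lim_{M\to\infty}\zeta^\mu_{*,M}(w)$ (so admissible $y_{\mathbf{k};\mathbf{m}}\mapsto\zeta^\mu(\mathbf{k};\mathbf{m})$, quasi-admissible $\mapsto\mathcal{D}^\mu(\mathbf{k};\mathbf{m};\tilde{\mathbf{m}})$). *)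

theory Defs
  imports
    "HOL-Analysis.Analysis"
    "HOL-Library.Poly_Mapping"
    "HOL-Library.FuncSet"
    "HOL-Computational_Algebra.Polynomial"
begin

inductive_set Qring :: "complex \<Rightarrow> complex set" for \<mu> :: complex where
  rat: "of_rat q \<in> Qring \<mu>"
| gen: "\<mu> \<in> Qring \<mu>"
| add: "a \<in> Qring \<mu> \<Longrightarrow> b \<in> Qring \<mu> \<Longrightarrow> a + b \<in> Qring \<mu>"
| mult: "a \<in> Qring \<mu> \<Longrightarrow> b \<in> Qring \<mu> \<Longrightarrow> a * b \<in> Qring \<mu>"

definition span_over ::
    "complex set \<Rightarrow> (complex \<Rightarrow> 'v \<Rightarrow> 'v) \<Rightarrow> 'v set \<Rightarrow> 'v::comm_monoid_add set" where
  "span_over R smul S =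
     {(\<Sum>x\<in>A. smul (c x) x) | A c. finite A \<and> A \<subseteq> S \<and> (\<forall>x\<in>A. c x \<in> R)}"

text \<open>The pair \<open>(k, m)\<close> is the letter \<open>y\<^bsub>k,m\<^esub>\<close>. The list
  \<open>[(k\<^sub>1, m\<^sub>1), \<dots>, (k\<^sub>r, m\<^sub>r)]\<close> encodes both the bi-index
  \<open>(k\<^sub>1, \<dots>, k\<^sub>r; m\<^sub>1, \<dots>, m\<^sub>r)\<close> and the word
  \<open>y\<^bsub>k\<^sub>1,m\<^sub>1\<^esub> \<cdots> y\<^bsub>k\<^sub>r,m\<^sub>r\<^esub>\<close>.\<close>

type_synonym letter = "nat \<times> rat"
type_synonym word = "letter list"

definition letters :: "letter set" where
  "letters = {(k, m). k \<ge> 1 \<and> m > 0}"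

definition positive :: "word \<Rightarrow> bool" where
  "positive w \<longleftrightarrow> set w \<subseteq> letters"

definition admissible :: "word \<Rightarrow> bool" where
  "admissible w \<longleftrightarrow> positive w \<and> (w \<noteq> [] \<longrightarrow> fst (last w) > 1)"

text \<open>\<open>special u m m'\<close> encodes the special triple whose two bi-indices are
  \<open>u @ [(1, m)]\<close> and \<open>u @ [(1, m')]\<close>.\<close>

definition special :: "word \<Rightarrow> rat \<Rightarrow> rat \<Rightarrow> bool" where
  "special u m m' \<longleftrightarrow> positive u \<and> m > 0 \<and> m' > 0 \<and> m \<noteq> m'"

definition sorted_tuples :: "nat \<Rightarrow> nat list set" where
  "sorted_tuples r = {ns. length ns = r \<and> sorted ns}"

definition denom :: "complex \<Rightarrow> word \<Rightarrow> nat list \<Rightarrow> complex" where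
  "denom \<mu> w ns =
     (\<Prod>i<length w. (of_nat (ns ! i) * \<mu> + of_rat (snd (w ! i))) ^ fst (w ! i))"

definition zeta_mu :: "complex \<Rightarrow> word \<Rightarrow> complex" where
  "zeta_mu \<mu> w = (\<Sum>\<^sub>\<infinity>ns\<in>sorted_tuples (length w). \<mu> ^ length w / denom \<mu> w ns)"

definition D_mu :: "complex \<Rightarrow> word \<Rightarrow> rat \<Rightarrow> rat \<Rightarrow> complex" where
  "D_mu \<mu> u m m' = of_rat (m' - m) *
     (\<Sum>\<^sub>\<infinity>ns\<in>sorted_tuples (length u + 1).
        \<mu> ^ (length u + 1) /
        (denom \<mu> u ns * (of_nat (ns ! length u) * \<mu> + of_rat m)
                        * (of_nat (ns ! length u) * \<mu> + of_rat m')))"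

definition Z_mu :: "complex \<Rightarrow> complex set" where
  "Z_mu \<mu> = span_over (Qring \<mu>) (*)
     ({1} \<union> {zeta_mu \<mu> w | w. admissible w} \<union> {D_mu \<mu> u m m' | u m m'. special u m m'})"

definition poly_over :: "complex set \<Rightarrow> complex poly set" where
  "poly_over R = {p. \<forall>n. coeff p n \<in> R}"

text \<open>Elements of the free algebra are finitely supported coefficient functions on words.
  As the coefficient ring depends on \<open>\<mu>\<close>, the algebra is the carrier set \<open>free_alg \<mu>\<close>.\<close>

type_synonym ncpoly = "word \<Rightarrow>\<^sub>0 complex"

definition free_alg :: "complex \<Rightarrow> ncpoly set" where
  "free_alg \<mu> = {p. \<forall>w\<in>Poly_Mapping.keys p. positive w \<and> Poly_Mapping.lookup p w \<in> Qring \<mu>}"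

definition wd :: "word \<Rightarrow> ncpoly" where
  "wd w = Poly_Mapping.single w 1"

definition nc_scale :: "complex \<Rightarrow> ncpoly \<Rightarrow> ncpoly" where
  "nc_scale c p = Poly_Mapping.map ((*) c) p"

definition conc :: "ncpoly \<Rightarrow> ncpoly \<Rightarrow> ncpoly" where
  "conc p q = (\<Sum>u\<in>Poly_Mapping.keys p. \<Sum>v\<in>Poly_Mapping.keys q.
     nc_scale (Poly_Mapping.lookup p u * Poly_Mapping.lookup q v) (wd (u @ v)))"

definition is_partial_fraction ::
    "letter \<Rightarrow> letter \<Rightarrow> (nat \<Rightarrow> rat) \<Rightarrow> (nat \<Rightarrow> rat) \<Rightarrow> bool" where
  "is_partial_fraction x1 x2 a b \<longleftrightarrow>
     (case (x1, x2) of ((k1, m1), (k2, m2)) \<Rightarrow>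
       (\<forall>x. x + m1 \<noteq> 0 \<longrightarrow> x + m2 \<noteq> 0 \<longrightarrow>
          1 / ((x + m1) ^ k1 * (x + m2) ^ k2)
          = (\<Sum>i=1..k1. a i / (x + m1) ^ i) + (\<Sum>j=1..k2. b j / (x + m2) ^ j)))"

lemma partial_fraction_exists_aux:
  fixes m1 m2 :: rat
  assumes "m1 \<noteq> m2"
  shows "k1 + k2 = n \<Longrightarrow> n \<ge> 1 \<Longrightarrow> \<exists>a b. \<forall>x. x + m1 \<noteq> 0 \<longrightarrow> x + m2 \<noteq> 0 \<longrightarrow>
          1 / ((x + m1) ^ k1 * (x + m2) ^ k2)
          = (\<Sum>i=1..k1. a i / (x + m1) ^ i) + (\<Sum>j=1..k2. b j / (x + m2) ^ j)"
proof (induction n arbitrary: k1 k2)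
  case 0 then show ?case by simp
next
  case (Suc n)
  show ?case
  proof (cases "k1 = 0 \<or> k2 = 0")
    case True
    have "(\<Sum>i=1..k. (if i = k then 1 else 0) / (y::rat) ^ i) = 1 / y ^ k" if "k \<ge> 1" for k y
    proof -
      have "(\<Sum>i=1..k. (if i = k then 1 else 0) / y ^ i) = (\<Sum>i=1..k. if i = k then 1 / y ^ k else 0)"
        by (rule sum.cong) auto
      then show ?thesis using that by simp
    qed
    then show ?thesis using True Suc.prems
      by (intro exI[of _ "\<lambda>i. if i = k1 then 1 else 0"] exI[of _ "\<lambda>i. if i = k2 then 1 else 0"]) auto
  next
    case False
    then obtain p q where pq: "k1 = Suc p" "k2 = Suc q" by (metis not0_implies_Suc)
    have n: "Suc p + q = n" "p + Suc q = n" "n \<ge> 1" using Suc.prems pq by auto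
    obtain a b where ab: "\<And>x. x + m1 \<noteq> 0 \<Longrightarrow> x + m2 \<noteq> 0 \<Longrightarrow>
          1 / ((x + m1) ^ Suc p * (x + m2) ^ q)
          = (\<Sum>i=1..Suc p. a i / (x + m1) ^ i) + (\<Sum>j=1..q. b j / (x + m2) ^ j)"
      using Suc.IH[OF n(1) n(3)] by blast
    obtain c d where cd: "\<And>x. x + m1 \<noteq> 0 \<Longrightarrow> x + m2 \<noteq> 0 \<Longrightarrow>
          1 / ((x + m1) ^ p * (x + m2) ^ Suc q)
          = (\<Sum>i=1..p. c i / (x + m1) ^ i) + (\<Sum>j=1..Suc q. d j / (x + m2) ^ j)"
      using Suc.IH[OF n(2) n(3)] by blast
    define D where "D = m2 - m1"
    have D: "D \<noteq> 0" using assms by (simp add: D_def)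
    define a' where "a' i = (a i - (if i \<le> p then c i else 0)) / D" for i
    define b' where "b' j = ((if j \<le> q then b j else 0) - d j) / D" for j
    have "1 / ((x + m1) ^ k1 * (x + m2) ^ k2)
          = (\<Sum>i=1..k1. a' i / (x + m1) ^ i) + (\<Sum>j=1..k2. b' j / (x + m2) ^ j)"
      if x: "x + m1 \<noteq> 0" "x + m2 \<noteq> 0" for x
    proof -
      have A: "(\<Sum>i=1..k1. a' i / (x + m1) ^ i) =
          ((\<Sum>i=1..Suc p. a i / (x + m1) ^ i) - (\<Sum>i=1..p. c i / (x + m1) ^ i)) / D"
        by (simp add: pq a'_def sum_divide_distrib sum_subtractf diff_divide_distrib add_divide_distrib mult.commute)
      have B: "(\<Sum>i=1..k2. b' i / (x + m2) ^ i) =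
          ((\<Sum>i=1..q. b i / (x + m2) ^ i) - (\<Sum>i=1..Suc q. d i / (x + m2) ^ i)) / D"
        by (simp add: pq b'_def sum_divide_distrib sum_subtractf diff_divide_distrib add_divide_distrib mult.commute)
      have "(\<Sum>i=1..k1. a' i / (x + m1) ^ i) + (\<Sum>j=1..k2. b' j / (x + m2) ^ j) =
         (1 / ((x + m1) ^ Suc p * (x + m2) ^ q) - 1 / ((x + m1) ^ p * (x + m2) ^ Suc q)) / D"
        unfolding A B ab[OF x] cd[OF x] by (simp add: add_divide_distrib diff_divide_distrib)
      also have "1 / ((x + m1) ^ Suc p * (x + m2) ^ q) - 1 / ((x + m1) ^ p * (x + m2) ^ Suc q)
         = ((x + m2) - (x + m1)) / ((x + m1) ^ Suc p * (x + m2) ^ Suc q)"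
        using x by (simp add: divide_simps)
      also have "\<dots> = D / ((x + m1) ^ k1 * (x + m2) ^ k2)" by (simp add: D_def pq)
      finally show ?thesis using D by simp
    qed
    then show ?thesis by blast
  qed
qed

lemma partial_fraction_exists:
  assumes "m1 \<noteq> m2" and "k1 \<ge> 1" and "k2 \<ge> 1"
  shows "\<exists>a b. is_partial_fraction (k1, m1) (k2, m2) a b"
  using partial_fraction_exists_aux[OF assms(1) refl, of k1 k2] assms(2)
  by (simp add: is_partial_fraction_def)

text \<open>The coefficients \<open>a\<^sub>1, \<dots>, a\<^bsub>k\<^sub>1\<^esub>\<close> and \<open>b\<^sub>1, \<dots>, b\<^bsub>k\<^sub>2\<^esub>\<close> are uniquely
  determined by the decomposition; the chosen functions are only used at these indices.\<close>

definition pf_coeffs :: "letter \<Rightarrow> letter \<Rightarrow> (nat \<Rightarrow> rat) \<times> (nat \<Rightarrow> rat)" where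
  "pf_coeffs x1 x2 = (SOME (a, b). is_partial_fraction x1 x2 a b)"

definition odot :: "letter \<Rightarrow> letter \<Rightarrow> ncpoly" where
  "odot x1 x2 =
     (case (x1, x2) of ((k1, m1), (k2, m2)) \<Rightarrow>
       if m1 = m2 then wd [(k1 + k2, m1)]
       else (case pf_coeffs x1 x2 of (a, b) \<Rightarrow>
         (\<Sum>i=1..k1. nc_scale (of_rat (a i)) (wd [(i, m1)])) +
         (\<Sum>j=1..k2. nc_scale (of_rat (b j)) (wd [(j, m2)]))))"

text \<open>The recursion peels off last letters; \<open>stuffle_word_snoc\<close> below is its usual form.\<close>

function (sequential) stuffle_word :: "complex \<Rightarrow> word \<Rightarrow> word \<Rightarrow> ncpoly" where
  "stuffle_word \<mu> [] w = wd w"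
| "stuffle_word \<mu> w [] = wd w"
| "stuffle_word \<mu> (x' # u') (y' # v') =
     (let u = butlast (x' # u'); x = last (x' # u'); v = butlast (y' # v'); y = last (y' # v') in
       conc (stuffle_word \<mu> u (y' # v')) (wd [x]) + conc (stuffle_word \<mu> (x' # u') v) (wd [y])
       - nc_scale \<mu> (conc (stuffle_word \<mu> u v) (odot x y)))"
  by pat_completeness auto
termination by (relation "Wellfounded.measure (\<lambda>(\<mu>, u, v). length u + length v)") auto

lemma stuffle_word_Nil [simp]:
  "stuffle_word \<mu> [] w = wd w" "stuffle_word \<mu> w [] = wd w"
  by simp (cases w; simp)

lemma stuffle_word_snoc:
  "stuffle_word \<mu> (u @ [x]) (v @ [y]) =
     conc (stuffle_word \<mu> u (v @ [y])) (wd [x]) + conc (stuffle_word \<mu> (u @ [x]) v) (wd [y])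
     - nc_scale \<mu> (conc (stuffle_word \<mu> u v) (odot x y))"
proof -
  obtain x' u' y' v' where e: "u @ [x] = x' # u'" "v @ [y] = y' # v'"
    by (metis append_is_Nil_conv list.exhaust not_Cons_self2)
  have "butlast (x' # u') = u" "last (x' # u') = x" "butlast (y' # v') = v" "last (y' # v') = y"
    by (metis e butlast_snoc, metis e last_snoc, metis e butlast_snoc, metis e last_snoc)
  then show ?thesis
    unfolding e by (simp only: stuffle_word.simps Let_def)
qed

declare stuffle_word.simps(3) [simp del]

definition stuffle :: "complex \<Rightarrow> ncpoly \<Rightarrow> ncpoly \<Rightarrow> ncpoly" where
  "stuffle \<mu> p q = (\<Sum>u\<in>Poly_Mapping.keys p. \<Sum>v\<in>Poly_Mapping.keys q.
     nc_scale (Poly_Mapping.lookup p u * Poly_Mapping.lookup q v) (stuffle_word \<mu> u v))"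

definition free_alg0 :: "complex \<Rightarrow> ncpoly set" where
  "free_alg0 \<mu> = span_over (Qring \<mu>) nc_scale
     ({wd w | w. admissible w} \<union>
      {wd (u @ [(1, m)]) - wd (u @ [(1, m')]) | u m m'. special u m m'})"

definition zeta_trunc_word :: "complex \<Rightarrow> nat \<Rightarrow> word \<Rightarrow> complex" where
  "zeta_trunc_word \<mu> M w =
     (\<Sum>ns | ns \<in> sorted_tuples (length w) \<and> set ns \<subseteq> {..M}. \<mu> ^ length w / denom \<mu> w ns)"

definition zeta_trunc :: "complex \<Rightarrow> nat \<Rightarrow> ncpoly \<Rightarrow> complex" where
  "zeta_trunc \<mu> M p =
     (\<Sum>w\<in>Poly_Mapping.keys p. Poly_Mapping.lookup p w * zeta_trunc_word \<mu> M w)"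

definition zeta_star :: "complex \<Rightarrow> ncpoly \<Rightarrow> complex" where
  "zeta_star \<mu> p = lim (\<lambda>M. zeta_trunc \<mu> M p)"

definition Q_linear_on :: "complex \<Rightarrow> ncpoly set \<Rightarrow> (ncpoly \<Rightarrow> complex poly) \<Rightarrow> bool" where
  "Q_linear_on \<mu> A f \<longleftrightarrow>
     (\<forall>p\<in>A. \<forall>q\<in>A. f (p + q) = f p + f q) \<and>
     (\<forall>c\<in>Qring \<mu>. \<forall>p\<in>A. f (nc_scale c p) = smult c (f p))"

end

theory Submission
  imports Defs "HOL-Real_Asymp.Real_Asymp"
begin

text \<open>Write \<open>y = y\<^bsub>1,m\<^esub>\<close> and let \<open>H\<^sub>M\<close> be its truncated zeta value, which grows like \<open>log M\<close>. Truncation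
  at a fixed \<open>M\<close> is a homomorphism for the \<open>\<mu>\<close>-stuffle product, and for \<open>w\<close> in the quasi-admissible part
  it converges to \<open>\<zeta>\<^sub>*(w)\<close> with an error that is \<open>O((log M)\<^sup>-\<^sup>j)\<close> for every \<open>j\<close>. Repeated stuffling with \<open>y\<close>,
  starting from the quasi-admissible part, generates the whole free algebra additively, because
  \<open>w y\<^sup>n * y = (n+1) w y\<^sup>n\<^sup>+\<^sup>1\<close> up to terms with fewer trailing letters \<open>y\<close>. This gives uniqueness. It also
  shows that the truncations of any \<open>p\<close> agree with \<open>P(H\<^sub>M)\<close>, up to such an error, for some polynomial \<open>P\<close> over
  \<open>Z\<^sup>\<mu>\<close>; \<open>P\<close> is unique since \<open>H\<^sub>M\<close> is unbounded, and \<open>p \<mapsto> P\<close> is the required map.\<close>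

section \<open>Submodules over the coefficient ring\<close>

text \<open>The map is built analytically. The relation between p and P compares sequences of
  complex numbers, so linearity and multiplicativity of p -> P follow from pointwise identities for
  the truncations together with uniqueness of P; the algebra has to supply, for each p, just some P.
  Divergence comes from last letters of weight one. The difference of two such letters converges, so
  modulo the quasi-admissible part each of them may be replaced by the one fixed letter y; hence
  every m > 0 is an equally good choice. Stuffling with y respects this because the merged letter in
  \<open>odot\<close> is quasi-admissible: a product of two or more linear denominators decays at
  least quadratically, which forces the residues to cancel. Plain convergence would be too weak a
  notion of error, since an o(1) term multiplied by H_M need not tend to 0. The errors that occur
  are bounded by powers of log M divided by M, and sequences smaller than every power of 1 / log M
  are stable under multiplication by polynomials in H_M.\<close>

lemma Qring_zero: "0 \<in> Qring \<mu>"
  using Qring.rat[of 0 \<mu>] by simp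

lemma Qring_one: "1 \<in> Qring \<mu>"
  using Qring.rat[of 1 \<mu>] by simp

lemma Qring_uminus: "c \<in> Qring \<mu> \<Longrightarrow> - c \<in> Qring \<mu>"
  using Qring.mult[OF Qring.rat[of "-1" \<mu>]] by fastforce

text \<open>The ambient scaling \<open>s\<close> is by all complex numbers, but the sets of interest
  are closed only under scalars from Q[\<mu>]. Since this ring depends on \<mu>, it is a set and not
  a type, and closure is stated as a predicate on carriers.\<close>

definition Qsubmodule :: "complex \<Rightarrow> (complex \<Rightarrow> 'v \<Rightarrow> 'v) \<Rightarrow> 'v::ab_group_add set \<Rightarrow> bool" where
  "Qsubmodule \<mu> s A \<longleftrightarrow> 0 \<in> A \<and> (\<forall>x\<in>A. \<forall>y\<in>A. x + y \<in> A) \<and> (\<forall>c\<in>Qring \<mu>. \<forall>x\<in>A. s c x \<in> A)"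

lemma QsubmoduleI:
  assumes "0 \<in> A" "\<And>x y. x \<in> A \<Longrightarrow> y \<in> A \<Longrightarrow> x + y \<in> A"
    "\<And>c x. c \<in> Qring \<mu> \<Longrightarrow> x \<in> A \<Longrightarrow> s c x \<in> A"
  shows "Qsubmodule \<mu> s A"
  using assms by (simp add: Qsubmodule_def)

lemma Qsubmodule_zero: "Qsubmodule \<mu> s A \<Longrightarrow> 0 \<in> A"
  and Qsubmodule_add: "Qsubmodule \<mu> s A \<Longrightarrow> x \<in> A \<Longrightarrow> y \<in> A \<Longrightarrow> x + y \<in> A"
  and Qsubmodule_scale: "Qsubmodule \<mu> s A \<Longrightarrow> c \<in> Qring \<mu> \<Longrightarrow> x \<in> A \<Longrightarrow> s c x \<in> A"
  by (simp_all add: Qsubmodule_def)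

lemma Qsubmodule_sum:
  assumes "Qsubmodule \<mu> s A" "\<And>i. i \<in> I \<Longrightarrow> f i \<in> A"
  shows "sum f I \<in> A"
  using assms(2)
  by (induction I rule: infinite_finite_induct)
     (auto intro: Qsubmodule_zero[OF assms(1)] Qsubmodule_add[OF assms(1)])

lemma Qsubmodule_diff:
  assumes "module s" "Qsubmodule \<mu> s A" "x \<in> A" "y \<in> A"
  shows "x - y \<in> A"
proof -
  interpret module s by fact
  have "x + s (-1) y \<in> A"
    using assms by (intro Qsubmodule_add[OF assms(2)] Qsubmodule_scale[OF assms(2)] Qring_uminus Qring_one)
  then show ?thesis by simp
qed

lemma span_over_subset:
  assumes "Qsubmodule \<mu> s A" "S \<subseteq> A"
  shows "span_over (Qring \<mu>) s S \<subseteq> A"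
  using assms(2) unfolding span_over_def
  by (auto intro!: Qsubmodule_sum[OF assms(1)] Qsubmodule_scale[OF assms(1)])

lemma span_over_base:
  assumes "module s" "x \<in> S"
  shows "x \<in> span_over (Qring \<mu>) s S"
proof -
  interpret module s by fact
  show ?thesis
    unfolding span_over_def mem_Collect_eq
    by (rule exI[of _ "{x}"], rule exI[of _ "\<lambda>_. 1"]) (use assms(2) Qring_one in auto)
qed

lemma Qsubmodule_span_over:
  assumes "module s"
  shows "Qsubmodule \<mu> s (span_over (Qring \<mu>) s S)"
proof (rule QsubmoduleI)
  interpret module s by fact
  show "0 \<in> span_over (Qring \<mu>) s S"
    unfolding span_over_def mem_Collect_eq by (rule exI[of _ "{}"]) auto
  fix x y
  assume x: "x \<in> span_over (Qring \<mu>) s S" and y: "y \<in> span_over (Qring \<mu>) s S"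
  obtain A c where A: "x = (\<Sum>z\<in>A. s (c z) z)" "finite A" "A \<subseteq> S" "\<forall>z\<in>A. c z \<in> Qring \<mu>"
    using x unfolding span_over_def by blast
  obtain B d where B: "y = (\<Sum>z\<in>B. s (d z) z)" "finite B" "B \<subseteq> S" "\<forall>z\<in>B. d z \<in> Qring \<mu>"
    using y unfolding span_over_def by blast
  \<comment> \<open>A span element carries one coefficient per generator, so the coefficients of the
    two sums are extended by 0 to the union and merged.\<close>
  define e where "e z = (if z \<in> A then c z else 0) + (if z \<in> B then d z else 0)" for z
  have "x = (\<Sum>z\<in>A \<union> B. s (if z \<in> A then c z else 0) z)"
    unfolding A(1) by (rule sum.mono_neutral_cong_left) (use A B in auto)
  moreover have "y = (\<Sum>z\<in>A \<union> B. s (if z \<in> B then d z else 0) z)"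
    unfolding B(1) by (rule sum.mono_neutral_cong_left) (use A B in auto)
  ultimately have "x + y = (\<Sum>z\<in>A \<union> B. s (e z) z)"
    by (simp only: sum.distrib[symmetric] scale_left_distrib e_def)
  moreover have "\<forall>z\<in>A \<union> B. e z \<in> Qring \<mu>"
    using A(4) B(4) Qring_zero[of \<mu>] by (auto simp: e_def intro: Qring.add)
  ultimately show "x + y \<in> span_over (Qring \<mu>) s S"
    unfolding span_over_def using A(2,3) B(2,3) by blast
next
  interpret module s by fact
  fix c x
  assume c: "c \<in> Qring \<mu>" and x: "x \<in> span_over (Qring \<mu>) s S"
  obtain A d where A: "x = (\<Sum>z\<in>A. s (d z) z)" "finite A" "A \<subseteq> S" "\<forall>z\<in>A. d z \<in> Qring \<mu>"
    using x unfolding span_over_def by blast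
  have "s c x = (\<Sum>z\<in>A. s (c * d z) z)"
    by (simp add: A(1) scale_sum_right)
  then show "s c x \<in> span_over (Qring \<mu>) s S"
    unfolding span_over_def using A c by (auto intro!: exI[of _ A] exI[of _ "\<lambda>z. c * d z"] Qring.mult)
qed

section \<open>The free algebra\<close>

lemma lookup_nc_scale [simp]: "Poly_Mapping.lookup (nc_scale c p) w = c * Poly_Mapping.lookup p w"
  by (simp add: nc_scale_def Poly_Mapping.map.rep_eq when_def)

interpretation nc: vector_space nc_scale
  by unfold_locales (auto intro!: poly_mapping_eqI simp: lookup_add algebra_simps)

lemma module_complex: "module ((*) :: complex \<Rightarrow> complex \<Rightarrow> complex)"
  by unfold_locales (auto simp: algebra_simps)

text \<open>Concatenation, stuffle product and truncation are all linear extensions from words.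
  Identifying them as such yields their linearity from one proof.\<close>

definition lin_ext :: "(complex \<Rightarrow> 'v \<Rightarrow> 'v) \<Rightarrow> (word \<Rightarrow> 'v) \<Rightarrow> ncpoly \<Rightarrow> 'v::ab_group_add" where
  "lin_ext s F p = (\<Sum>w\<in>Poly_Mapping.keys p. s (Poly_Mapping.lookup p w) (F w))"

text \<open>Addition may cancel terms and shrink the set of keys; a common superset makes the sums
  for \<open>p\<close>, \<open>q\<close> and \<open>p + q\<close> comparable.\<close>

lemma lin_ext_superset:
  assumes "module s" "finite K" "Poly_Mapping.keys p \<subseteq> K"
  shows "lin_ext s F p = (\<Sum>w\<in>K. s (Poly_Mapping.lookup p w) (F w))"
proof -
  interpret module s by fact
  show ?thesis
    unfolding lin_ext_def using assms(2,3)
    by (intro sum.mono_neutral_left) (auto simp: in_keys_iff)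
qed

lemma module_hom_lin_ext:
  assumes "module s"
  shows "module_hom nc_scale s (lin_ext s F)"
proof -
  interpret s: module s by fact
  show ?thesis
  proof unfold_locales
    fix p q :: ncpoly
    let ?K = "Poly_Mapping.keys p \<union> Poly_Mapping.keys q"
    have "lin_ext s F r = (\<Sum>w\<in>?K. s (Poly_Mapping.lookup r w) (F w))"
      if "r \<in> {p, q, p + q}" for r
      using that by (intro lin_ext_superset assms) (use Poly_Mapping.keys_add[of p q] in auto)
    then show "lin_ext s F (p + q) = lin_ext s F p + lin_ext s F q"
      by (simp add: lookup_add s.scale_left_distrib sum.distrib)
  next
    fix c :: complex and p :: ncpoly
    have "lin_ext s F (nc_scale c p)
        = (\<Sum>w\<in>Poly_Mapping.keys p. s (Poly_Mapping.lookup (nc_scale c p) w) (F w))"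
      by (rule lin_ext_superset[OF assms]) (auto simp: in_keys_iff)
    then show "lin_ext s F (nc_scale c p) = s c (lin_ext s F p)"
      by (simp add: lin_ext_def s.scale_sum_right)
  qed
qed

lemma lin_ext_wd:
  assumes "module s"
  shows "lin_ext s F (wd w) = F w"
proof -
  interpret s: module s by fact
  show ?thesis by (simp add: lin_ext_def wd_def)
qed

lemma ncpoly_eq_sum: "p = (\<Sum>w\<in>Poly_Mapping.keys p. nc_scale (Poly_Mapping.lookup p w) (wd w))"
proof (rule poly_mapping_eqI)
  fix v
  have "Poly_Mapping.lookup (\<Sum>w\<in>Poly_Mapping.keys p. nc_scale (Poly_Mapping.lookup p w) (wd w)) v
      = (\<Sum>w\<in>Poly_Mapping.keys p. if w = v then Poly_Mapping.lookup p v else 0)"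
    unfolding lookup_sum lookup_nc_scale wd_def lookup_single when_def by (rule sum.cong) auto
  also have "\<dots> = Poly_Mapping.lookup p v"
    by (simp add: in_keys_iff)
  finally show "Poly_Mapping.lookup p v = Poly_Mapping.lookup
      (\<Sum>w\<in>Poly_Mapping.keys p. nc_scale (Poly_Mapping.lookup p w) (wd w)) v" by simp
qed

lemma module_hom_ncpoly_eqI:
  assumes "module_hom nc_scale s f" "module_hom nc_scale s g" "\<And>w. f (wd w) = g (wd w)"
  shows "f p = g p"
proof -
  interpret f: module_hom nc_scale s f by fact
  interpret g: module_hom nc_scale s g by fact
  show ?thesis
    by (subst (1 2) ncpoly_eq_sum) (simp add: f.sum g.sum f.scale g.scale assms(3))
qed

lemma module_hom_comp:
  "module_hom s1 s2 f \<Longrightarrow> module_hom s2 s3 g \<Longrightarrow> module_hom s1 s3 (\<lambda>x. g (f x))"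
  using module_hom_compose[of s1 s2 f s3 g] by (simp add: comp_def)

lemma module_hom_lin_ext_right:
  assumes "module s" "\<And>u. module_hom nc_scale s (F u)"
  shows "module_hom nc_scale s (\<lambda>q. lin_ext s (\<lambda>u. F u q) p)"
proof -
  interpret s: module s by fact
  interpret F: module_hom nc_scale s "F u" for u by (rule assms)
  show ?thesis
    by unfold_locales
       (simp_all add: lin_ext_def F.add F.scale s.scale_right_distrib sum.distrib s.scale_sum_right
          mult.commute)
qed

lemma conc_lin_ext: "conc p q = lin_ext nc_scale (\<lambda>u. lin_ext nc_scale (\<lambda>v. wd (u @ v)) q) p"
  by (simp add: conc_def lin_ext_def nc.scale_sum_right)

lemma stuffle_lin_ext: "stuffle \<mu> p q = lin_ext nc_scale (\<lambda>u. lin_ext nc_scale (stuffle_word \<mu> u) q) p"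
  by (simp add: stuffle_def lin_ext_def nc.scale_sum_right)

lemma zeta_trunc_lin_ext: "zeta_trunc \<mu> M = lin_ext (*) (zeta_trunc_word \<mu> M)"
  by (rule ext) (simp add: zeta_trunc_def lin_ext_def)

interpretation conc_left: module_hom nc_scale nc_scale "\<lambda>p. conc p q" for q
  unfolding conc_lin_ext by (rule module_hom_lin_ext[OF nc.module_axioms])

interpretation conc_right: module_hom nc_scale nc_scale "conc p" for p
  unfolding conc_lin_ext
  by (intro module_hom_lin_ext_right module_hom_lin_ext nc.module_axioms)

interpretation stuffle_left: module_hom nc_scale nc_scale "\<lambda>p. stuffle \<mu> p q" for \<mu> q
  unfolding stuffle_lin_ext by (rule module_hom_lin_ext[OF nc.module_axioms])

interpretation stuffle_right: module_hom nc_scale nc_scale "stuffle \<mu> p" for \<mu> p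
  unfolding stuffle_lin_ext
  by (intro module_hom_lin_ext_right module_hom_lin_ext nc.module_axioms)

interpretation zeta_trunc: module_hom nc_scale "(*)" "zeta_trunc \<mu> M" for \<mu> M
  unfolding zeta_trunc_lin_ext by (rule module_hom_lin_ext[OF module_complex])

lemma conc_wd [simp]: "conc (wd u) (wd v) = wd (u @ v)"
  by (simp add: conc_lin_ext lin_ext_wd[OF nc.module_axioms])

lemma stuffle_wd [simp]: "stuffle \<mu> (wd u) (wd v) = stuffle_word \<mu> u v"
  by (simp add: stuffle_lin_ext lin_ext_wd[OF nc.module_axioms])

lemma zeta_trunc_wd [simp]: "zeta_trunc \<mu> M (wd w) = zeta_trunc_word \<mu> M w"
  by (simp add: zeta_trunc_lin_ext lin_ext_wd[OF module_complex])

lemma conc_Nil_right [simp]: "conc p (wd []) = p"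
  by (rule module_hom_ncpoly_eqI[OF conc_left.module_hom_axioms, where g = "\<lambda>p. p"])
     (unfold_locales, simp_all)

lemma conc_assoc_wd: "conc (conc p (wd u)) (wd v) = conc p (wd (u @ v))"
  by (rule module_hom_ncpoly_eqI[OF module_hom_comp[OF conc_left.module_hom_axioms
        conc_left.module_hom_axioms] conc_left.module_hom_axioms]) simp

section \<open>The carrier over Q[\<mu>] and its closure under the products\<close>

lemma Qsubmodule_free_alg: "Qsubmodule \<mu> nc_scale (free_alg \<mu>)"
proof (rule QsubmoduleI)
  \<comment> \<open>Since 0 lies in Q[\<mu>], membership can be tested at every word, not only at
    the keys, so cancellation in sums needs no care.\<close>
  have *: "p \<in> free_alg \<mu> \<longleftrightarrow>
    (\<forall>w. Poly_Mapping.lookup p w \<in> Qring \<mu> \<and> (positive w \<or> Poly_Mapping.lookup p w = 0))" for p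
    using Qring_zero[of \<mu>] unfolding free_alg_def by (fastforce simp: in_keys_iff)
  show "0 \<in> free_alg \<mu>" by (simp add: free_alg_def)
  show "x + y \<in> free_alg \<mu>" if "x \<in> free_alg \<mu>" "y \<in> free_alg \<mu>" for x y
    using that unfolding * by (fastforce simp: lookup_add intro: Qring.add)
  show "nc_scale c x \<in> free_alg \<mu>" if "c \<in> Qring \<mu>" "x \<in> free_alg \<mu>" for c x
    using that unfolding * by (auto intro: Qring.mult)
qed

lemma wd_in_free_alg: "positive w \<Longrightarrow> wd w \<in> free_alg \<mu>"
  by (simp add: free_alg_def wd_def Qring_one)

text \<open>Serves as an induction principle: with \<open>A\<close> the set of elements having a
  linear property, the property need only be checked on positive words.\<close>

lemma free_alg_subset:
  assumes "Qsubmodule \<mu> nc_scale A" "\<And>w. positive w \<Longrightarrow> wd w \<in> A"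
  shows "free_alg \<mu> \<subseteq> A"
proof
  fix p assume "p \<in> free_alg \<mu>"
  then show "p \<in> A"
    by (subst ncpoly_eq_sum, intro Qsubmodule_sum[OF assms(1)] Qsubmodule_scale[OF assms(1)] assms(2))
       (auto simp: free_alg_def)
qed

lemma Qsubmodule_vimage:
  assumes "module_hom s1 s2 f" "Qsubmodule \<mu> s2 A"
  shows "Qsubmodule \<mu> s1 {p. f p \<in> A}"
proof -
  interpret f: module_hom s1 s2 f by fact
  show ?thesis
    using assms(2) by (auto simp: Qsubmodule_def f.add f.scale f.zero)
qed

lemma positive_append [simp]: "positive (u @ v) \<longleftrightarrow> positive u \<and> positive v"
  by (auto simp: positive_def)

lemma positive_Nil [simp]: "positive []"
  by (simp add: positive_def)

lemma positive_singleton: "positive [x] \<longleftrightarrow> x \<in> letters"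
  by (simp add: positive_def)

lemma conc_in_free_alg:
  assumes "p \<in> free_alg \<mu>" "q \<in> free_alg \<mu>"
  shows "conc p q \<in> free_alg \<mu>"
proof -
  have "free_alg \<mu> \<subseteq> {q. conc (wd u) q \<in> free_alg \<mu>}" if "positive u" for u
    by (rule free_alg_subset[OF Qsubmodule_vimage[OF conc_right.module_hom_axioms Qsubmodule_free_alg]])
       (simp add: that wd_in_free_alg)
  with assms(2) have "free_alg \<mu> \<subseteq> {p. conc p q \<in> free_alg \<mu>}"
    by (intro free_alg_subset[OF Qsubmodule_vimage[OF conc_left.module_hom_axioms Qsubmodule_free_alg]]) auto
  with assms(1) show ?thesis by auto
qed

lemma odot_in_free_alg:
  assumes "x \<in> letters" "y \<in> letters"
  shows "odot x y \<in> free_alg \<mu>"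
  using assms
  by (auto simp: odot_def letters_def positive_singleton split: prod.splits
       intro!: wd_in_free_alg Qsubmodule_add[OF Qsubmodule_free_alg] Qsubmodule_sum[OF Qsubmodule_free_alg]
         Qsubmodule_scale[OF Qsubmodule_free_alg] Qring.rat)

lemma stuffle_word_in_free_alg:
  "positive u \<Longrightarrow> positive v \<Longrightarrow> stuffle_word \<mu> u v \<in> free_alg \<mu>"
proof (induction u arbitrary: v rule: rev_induct)
  case Nil
  then show ?case by (simp add: wd_in_free_alg)
next
  case (snoc x u)
  note u = snoc
  from snoc.prems(2) show ?case
  proof (induction v rule: rev_induct)
    case Nil
    then show ?case using u(2) by (simp add: wd_in_free_alg)
  next
    case (snoc y v)
    then have "stuffle_word \<mu> (u @ [x]) v \<in> free_alg \<mu>" by simp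
    with u snoc.prems show ?case
      unfolding stuffle_word_snoc
      by (intro Qsubmodule_diff[OF nc.module_axioms Qsubmodule_free_alg] Qsubmodule_add[OF Qsubmodule_free_alg]
          Qsubmodule_scale[OF Qsubmodule_free_alg] conc_in_free_alg wd_in_free_alg odot_in_free_alg Qring.gen)
         (auto simp: positive_singleton)
  qed
qed

lemma stuffle_in_free_alg:
  assumes "p \<in> free_alg \<mu>" "q \<in> free_alg \<mu>"
  shows "stuffle \<mu> p q \<in> free_alg \<mu>"
proof -
  have "free_alg \<mu> \<subseteq> {q. stuffle \<mu> (wd u) q \<in> free_alg \<mu>}" if "positive u" for u
    by (rule free_alg_subset[OF Qsubmodule_vimage[OF stuffle_right.module_hom_axioms Qsubmodule_free_alg]])
       (simp add: that stuffle_word_in_free_alg)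
  with assms(2) have "free_alg \<mu> \<subseteq> {p. stuffle \<mu> p q \<in> free_alg \<mu>}"
    by (intro free_alg_subset[OF Qsubmodule_vimage[OF stuffle_left.module_hom_axioms Qsubmodule_free_alg]]) auto
  with assms(1) show ?thesis by auto
qed

section \<open>Partial fractions\<close>

lemma pf_coeffs_partial_fraction:
  assumes "(k1, m1) \<in> letters" "(k2, m2) \<in> letters" "m1 \<noteq> m2"
    and "pf_coeffs (k1, m1) (k2, m2) = (a, b)"
  shows "is_partial_fraction (k1, m1) (k2, m2) a b"
proof -
  have "\<exists>ab. case ab of (a, b) \<Rightarrow> is_partial_fraction (k1, m1) (k2, m2) a b"
    using partial_fraction_exists[OF assms(3), of k1 k2] assms(1,2) by (auto simp: letters_def)
  from someI_ex[OF this] show ?thesis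
    using assms(4) by (simp add: pf_coeffs_def)
qed

text \<open>Put x = n in the decomposition, multiply by n and let n tend to infinity. On the right
  only the terms of order one survive, with limit \<open>a 1 + b 1\<close>; the left side tends to
  0. Positivity of the shifts keeps all natural numbers away from the poles.\<close>

lemma partial_fraction_residues:
  assumes pf: "is_partial_fraction (k1, m1) (k2, m2) a b"
    and k: "k1 \<ge> 1" "k2 \<ge> 1" and m: "m1 > 0" "m2 > 0"
  shows "a 1 + b 1 = 0"
proof -
  have lim: "(\<lambda>n. real n * (of_rat c / (real n + of_rat m) ^ i)) \<longlonglongrightarrow> (if i = 1 then of_rat c else 0)"
    if "i \<ge> 1" for c m :: rat and i
  proof (cases "i = 1")
    case True
    then show ?thesis by simp real_asymp
  next
    case False
    with that have "2 \<le> i" by simp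
    then obtain j where j: "i = j + 2" using le_Suc_ex add.commute by metis
    show ?thesis unfolding j by simp real_asymp
  qed
  have lim_sum: "(\<lambda>n. \<Sum>i=1..k. real n * (of_rat (c i) / (real n + of_rat m) ^ i)) \<longlonglongrightarrow> of_rat (c 1)"
    if "k \<ge> 1" for c m and k :: nat
  proof -
    have "(\<lambda>n. \<Sum>i=1..k. real n * (of_rat (c i) / (real n + of_rat m) ^ i))
        \<longlonglongrightarrow> (\<Sum>i=1..k. if i = 1 then of_rat (c i) else 0)"
      by (intro tendsto_sum lim) auto
    also have "(\<Sum>i=1..k. if i = 1 then of_rat (c i) else 0) = (of_rat (c 1) :: real)"
      using that by simp
    finally show ?thesis .
  qed
  have eq: "real n * (1 / ((real n + of_rat m1) ^ k1 * (real n + of_rat m2) ^ k2))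
      = (\<Sum>i=1..k1. real n * (of_rat (a i) / (real n + of_rat m1) ^ i))
        + (\<Sum>j=1..k2. real n * (of_rat (b j) / (real n + of_rat m2) ^ j))" for n
  proof -
    have "rat_of_nat n + m1 > 0" "rat_of_nat n + m2 > 0"
      using m by (simp_all add: add_nonneg_pos)
    then have "1 / ((rat_of_nat n + m1) ^ k1 * (rat_of_nat n + m2) ^ k2)
          = (\<Sum>i=1..k1. a i / (rat_of_nat n + m1) ^ i) + (\<Sum>j=1..k2. b j / (rat_of_nat n + m2) ^ j)"
      using pf by (auto simp: is_partial_fraction_def)
    from arg_cong[OF this, of "of_rat :: rat \<Rightarrow> real"] show ?thesis
      unfolding sum_distrib_left[symmetric] distrib_left[symmetric]
      by (simp add: of_rat_divide of_rat_add of_rat_mult of_rat_power of_rat_sum)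
  qed
  \<comment> \<open>Both exponents are successors, so the denominator has degree at least two in n
    and outweighs the factor n.\<close>
  obtain j1 j2 where j: "k1 = Suc j1" "k2 = Suc j2"
    using k by (metis Suc_le_D One_nat_def)
  have "(\<lambda>n. real n * (1 / ((real n + of_rat m1) ^ k1 * (real n + of_rat m2) ^ k2))) \<longlonglongrightarrow> 0"
    unfolding j by real_asymp
  moreover have "(\<lambda>n. real n * (1 / ((real n + of_rat m1) ^ k1 * (real n + of_rat m2) ^ k2)))
      \<longlonglongrightarrow> of_rat (a 1) + of_rat (b 1)"
    unfolding eq by (intro tendsto_add lim_sum k)
  ultimately have "(of_rat (a 1) + of_rat (b 1) :: real) = 0"
    using LIMSEQ_unique by blast
  then show ?thesis
    by (simp flip: of_rat_add)
qed

text \<open>The coefficients are specified by an identity at rational points only. Clearing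
  denominators turns it into the polynomial \<open>P\<close>, which vanishes at all rationals except
  possibly two, hence identically, so the identity holds at complex points.\<close>

lemma partial_fraction_complex:
  fixes z :: complex
  assumes pf: "is_partial_fraction (k1, m1) (k2, m2) a b"
    and z: "z + of_rat m1 \<noteq> 0" "z + of_rat m2 \<noteq> 0"
  shows "1 / ((z + of_rat m1) ^ k1 * (z + of_rat m2) ^ k2)
    = (\<Sum>i=1..k1. of_rat (a i) / (z + of_rat m1) ^ i) + (\<Sum>j=1..k2. of_rat (b j) / (z + of_rat m2) ^ j)"
proof -
  define p1 p2 :: "complex poly" where "p1 = [:of_rat m1, 1:]" and "p2 = [:of_rat m2, 1:]"
  define P where "P = (\<Sum>i=1..k1. smult (of_rat (a i)) (p1 ^ (k1 - i))) * p2 ^ k2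
     + p1 ^ k1 * (\<Sum>j=1..k2. smult (of_rat (b j)) (p2 ^ (k2 - j))) - 1"
  have P: "poly P x = (x + of_rat m1) ^ k1 * (x + of_rat m2) ^ k2 *
      ((\<Sum>i=1..k1. of_rat (a i) / (x + of_rat m1) ^ i) + (\<Sum>j=1..k2. of_rat (b j) / (x + of_rat m2) ^ j)) - 1"
    if x: "x + of_rat m1 \<noteq> 0" "x + of_rat m2 \<noteq> 0" for x
  proof -
    have "(\<Sum>i=1..k. c i * y ^ (k - i)) = y ^ k * (\<Sum>i=1..k. c i / y ^ i)"
      if "y \<noteq> 0" for y :: complex and c k
      using that by (auto simp: sum_distrib_left power_diff intro!: sum.cong)
    from this[OF x(1)] this[OF x(2)] show ?thesis
      by (simp add: P_def p1_def p2_def poly_sum add.commute algebra_simps)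
  qed
  have zero: "poly P (of_rat x) = 0" if x: "x + m1 \<noteq> 0" "x + m2 \<noteq> 0" for x
  proof -
    have "1 / ((x + m1) ^ k1 * (x + m2) ^ k2)
          = (\<Sum>i=1..k1. a i / (x + m1) ^ i) + (\<Sum>j=1..k2. b j / (x + m2) ^ j)"
      using pf x by (auto simp: is_partial_fraction_def)
    from arg_cong[OF this, of "of_rat :: rat \<Rightarrow> complex"]
    have eq: "1 / ((of_rat x + of_rat m1) ^ k1 * (of_rat x + of_rat m2) ^ k2) =
      ((\<Sum>i=1..k1. of_rat (a i) / (of_rat x + of_rat m1) ^ i)
        + (\<Sum>j=1..k2. of_rat (b j) / (of_rat x + of_rat m2) ^ j) :: complex)"
      by (simp add: of_rat_divide of_rat_add of_rat_mult of_rat_power of_rat_sum)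
    have "of_rat x + of_rat m1 \<noteq> (0::complex)" "of_rat x + of_rat m2 \<noteq> (0::complex)"
      using x by (simp_all flip: of_rat_add)
    then show ?thesis by (simp add: P flip: eq[simplified])
  qed
  have "P = 0"
  proof (rule ccontr)
    assume "P \<noteq> 0"
    then have "finite {x. poly P x = 0}" by (rule poly_roots_finite)
    moreover have "(of_rat :: rat \<Rightarrow> complex) ` (- {-m1, -m2}) \<subseteq> {x. poly P x = 0}"
      by (auto intro!: zero simp: eq_neg_iff_add_eq_0)
    ultimately have "finite ((of_rat :: rat \<Rightarrow> complex) ` (- {-m1, -m2}))"
      using finite_subset by blast
    then have "finite (- {-m1, -m2})"
      by (rule finite_imageD) (auto simp: inj_on_def)
    then have "finite (- {-m1, -m2} \<union> {-m1, -m2})" by simp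
    then show False
      using infinite_UNIV_char_0[where 'a = rat] by (simp only: Compl_partition2)
  qed
  with P[OF z] z show ?thesis by (simp add: field_simps)
qed

section \<open>Truncated nested sums\<close>

text \<open>Arbitrary weight functions are allowed because three kinds occur: the functions of
  letters, their real-valued norms, and the kernel of \<open>D_mu\<close> in the last place, which
  belongs to no single letter.\<close>

definition nested_sum :: "(nat \<Rightarrow> 'a::comm_semiring_1) list \<Rightarrow> nat \<Rightarrow> 'a" where
  "nested_sum fs M = (\<Sum>ns | ns \<in> sorted_tuples (length fs) \<and> set ns \<subseteq> {..M}. \<Prod>i<length fs. (fs ! i) (ns ! i))"

lemma finite_truncated_tuples: "finite {ns. ns \<in> sorted_tuples r \<and> set ns \<subseteq> {..M}}"
  by (rule finite_subset[OF _ finite_lists_length_eq[of "{..M}" r]]) (auto simp: sorted_tuples_def)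

lemma nested_sum_Nil [simp]: "nested_sum [] M = 1"
proof -
  have "{ns. ns \<in> sorted_tuples 0 \<and> set ns \<subseteq> {..M}} = {[]}"
    by (auto simp: sorted_tuples_def)
  then show ?thesis by (simp add: nested_sum_def)
qed

text \<open>Splits off the largest index n. Sortedness of the whole tuple says that the remaining
  tuple is sorted and truncated at n, which is the inner nested sum.\<close>

lemma nested_sum_snoc: "nested_sum (fs @ [g]) M = (\<Sum>n\<le>M. nested_sum fs n * g n)"
proof -
  let ?T = "\<lambda>r n. {ns. ns \<in> sorted_tuples r \<and> set ns \<subseteq> {..n}}"
  let ?r = "length fs"
  have bij: "bij_betw (\<lambda>(n, ns). ns @ [n]) (SIGMA n:{..M}. ?T ?r n) (?T (Suc ?r) M)"
  proof (rule bij_betw_byWitness[where f' = "\<lambda>ns. (last ns, butlast ns)"])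
    show "\<forall>ns\<in>?T (Suc ?r) M. (case (last ns, butlast ns) of (n, ns) \<Rightarrow> ns @ [n]) = ns"
      by (auto simp: sorted_tuples_def intro!: append_butlast_last_id)
    show "(\<lambda>ns. (last ns, butlast ns)) ` ?T (Suc ?r) M \<subseteq> (SIGMA n:{..M}. ?T ?r n)"
    proof (rule image_subsetI)
      fix ns assume "ns \<in> ?T (Suc ?r) M"
      moreover from this have "ns = butlast ns @ [last ns]"
        by (intro append_butlast_last_id[symmetric]) (auto simp: sorted_tuples_def)
      then obtain us n where "ns = us @ [n]" by blast
      ultimately show "(last ns, butlast ns) \<in> (SIGMA n:{..M}. ?T ?r n)"
        by (auto simp: sorted_tuples_def sorted_append)
    qed
  qed (auto simp: sorted_tuples_def sorted_append)
  have "nested_sum (fs @ [g]) M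
      = (\<Sum>(n, ns)\<in>(SIGMA n:{..M}. ?T ?r n). \<Prod>i<Suc ?r. ((fs @ [g]) ! i) ((ns @ [n]) ! i))"
    unfolding nested_sum_def length_append_singleton
    by (subst sum.reindex_bij_betw[OF bij, symmetric]) (simp add: case_prod_unfold)
  also have "\<dots> = (\<Sum>(n, ns)\<in>(SIGMA n:{..M}. ?T ?r n). (\<Prod>i<?r. (fs ! i) (ns ! i)) * g n)"
    by (intro sum.cong refl) (auto simp: nth_append sorted_tuples_def)
  also have "\<dots> = (\<Sum>n\<le>M. nested_sum fs n * g n)"
    by (subst sum.Sigma[symmetric])
       (auto simp: finite_truncated_tuples nested_sum_def sum_distrib_right)
  finally show ?thesis .
qed

text \<open>The power \<open>\<mu> ^ r\<close> in front of the series is distributed, one factor to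
  each letter, so that a word becomes a nested sum of independent weights.\<close>

definition letter_fun :: "complex \<Rightarrow> letter \<Rightarrow> nat \<Rightarrow> complex" where
  "letter_fun \<mu> x n = \<mu> / (of_nat n * \<mu> + of_rat (snd x)) ^ fst x"

lemma prod_letter_fun: "(\<Prod>i<length w. (map (letter_fun \<mu>) w ! i) (ns ! i)) = \<mu> ^ length w / denom \<mu> w ns"
  by (simp add: denom_def letter_fun_def prod_dividef)

lemma zeta_trunc_word_nested_sum: "zeta_trunc_word \<mu> M w = nested_sum (map (letter_fun \<mu>) w) M"
  unfolding zeta_trunc_word_def nested_sum_def length_map prod_letter_fun ..

lemma zeta_trunc_word_Nil [simp]: "zeta_trunc_word \<mu> M [] = 1"
  by (simp add: zeta_trunc_word_nested_sum)

lemma zeta_trunc_word_snoc: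
  "zeta_trunc_word \<mu> M (w @ [x]) = (\<Sum>n\<le>M. zeta_trunc_word \<mu> n w * letter_fun \<mu> x n)"
  by (simp add: zeta_trunc_word_nested_sum nested_sum_snoc)

lemma zeta_trunc_conc_letter:
  "zeta_trunc \<mu> M (conc p (wd [x])) = (\<Sum>n\<le>M. zeta_trunc \<mu> n p * letter_fun \<mu> x n)"
proof (rule module_hom_ncpoly_eqI[OF module_hom_comp[OF conc_left.module_hom_axioms zeta_trunc.module_hom_axioms]])
  interpret c: module "(*) :: complex \<Rightarrow> complex \<Rightarrow> complex" by (rule module_complex)
  show "module_hom nc_scale (*) (\<lambda>p. \<Sum>n\<le>M. zeta_trunc \<mu> n p * letter_fun \<mu> x n)"
    by unfold_locales
       (simp_all add: zeta_trunc.add zeta_trunc.scale distrib_right sum.distrib sum_distrib_left mult.assoc)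
qed (simp add: zeta_trunc_word_snoc)

section \<open>Multiplicativity of truncation for the stuffle product\<close>

lemma complex_of_rat_eq: "complex_of_rat q = complex_of_real (real_of_rat q)"
  by (cases q) (simp add: of_rat_rat)

lemma nonzero_denominator:
  assumes "Re \<mu> > 0" "m > 0"
  shows "of_nat n * \<mu> + of_rat m \<noteq> 0"
proof -
  have "Re (of_nat n * \<mu> + of_rat m) = real n * Re \<mu> + of_rat m"
    by (simp add: complex_of_rat_eq)
  also have "\<dots> > 0" using assms by (simp add: add_nonneg_pos)
  finally show ?thesis by (metis less_irrefl zero_complex.simps(1))
qed

text \<open>Partial fractions at the point z = n \<mu> decompose the product of two letter
  functions. That product carries two factors \<mu> and a single letter only one, which is the
  origin of the coefficient \<mu> before \<open>odot\<close> in the stuffle product.\<close>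

lemma zeta_trunc_conc_odot:
  assumes \<mu>: "Re \<mu> > 0" and xy: "x \<in> letters" "y \<in> letters"
  shows "\<mu> * zeta_trunc \<mu> M (conc p (odot x y))
    = (\<Sum>n\<le>M. zeta_trunc \<mu> n p * (letter_fun \<mu> x n * letter_fun \<mu> y n))"
proof -
  obtain k1 m1 k2 m2 where e: "x = (k1, m1)" "y = (k2, m2)" by (metis surj_pair)
  have m: "m1 > 0" "m2 > 0" using xy by (auto simp: e letters_def)
  show ?thesis
  proof (cases "m1 = m2")
    case True
    then show ?thesis
      by (simp add: odot_def e zeta_trunc_conc_letter letter_fun_def sum_distrib_left power_add mult_ac)
  next
    case False
    obtain a b where ab: "pf_coeffs x y = (a, b)" by (metis surj_pair)
    have pf: "is_partial_fraction (k1, m1) (k2, m2) a b"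
      using pf_coeffs_partial_fraction[of k1 m1 k2 m2 a b] xy ab False by (simp add: e)
    have "letter_fun \<mu> x n * letter_fun \<mu> y n
        = \<mu> * ((\<Sum>i=1..k1. of_rat (a i) * letter_fun \<mu> (i, m1) n)
             + (\<Sum>j=1..k2. of_rat (b j) * letter_fun \<mu> (j, m2) n))" for n
      using arg_cong[OF partial_fraction_complex[OF pf nonzero_denominator[OF \<mu> m(1), of n]
          nonzero_denominator[OF \<mu> m(2), of n]], of "\<lambda>t. \<mu> * (\<mu> * t)"]
      by (simp add: letter_fun_def e sum_distrib_left distrib_left mult_ac)
    then have "(\<Sum>n\<le>M. zeta_trunc \<mu> n p * (letter_fun \<mu> x n * letter_fun \<mu> y n))
       = \<mu> * ((\<Sum>n\<le>M. \<Sum>i=1..k1. of_rat (a i) * (zeta_trunc \<mu> n p * letter_fun \<mu> (i, m1) n))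
             + (\<Sum>n\<le>M. \<Sum>j=1..k2. of_rat (b j) * (zeta_trunc \<mu> n p * letter_fun \<mu> (j, m2) n)))"
      by (simp add: sum_distrib_left sum.distrib distrib_left mult_ac)
    also have "\<dots> = \<mu> * zeta_trunc \<mu> M (conc p (odot x y))"
      unfolding sum.swap[of _ _ "{..M}"] odot_def
      using False ab
      by (simp add: e conc_right.add conc_right.sum conc_right.scale zeta_trunc.add
          zeta_trunc.sum zeta_trunc.scale zeta_trunc_conc_letter sum_distrib_left)
    finally show ?thesis by simp
  qed
qed

text \<open>The triangles j \<le> i and i \<le> j cover the square and overlap in the diagonal. The
  subtraction of the diagonal becomes the minus sign in the stuffle recursion.\<close>

lemma sum_mult_sum_partial_sums:
  fixes a b :: "nat \<Rightarrow> 'a::comm_ring_1"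
  shows "(\<Sum>i\<le>M. a i) * (\<Sum>j\<le>M. b j)
    = (\<Sum>i\<le>M. a i * (\<Sum>j\<le>i. b j)) + (\<Sum>j\<le>M. (\<Sum>i\<le>j. a i) * b j) - (\<Sum>n\<le>M. a n * b n)"
  by (induction M) (simp_all add: algebra_simps)

text \<open>Splitting the square of the two outermost indices reproduces the stuffle recursion. The
  bound \<open>M\<close> is arbitrary in both inductions, as the shorter products are needed at
  every n \<le> \<open>M\<close>.\<close>

lemma zeta_trunc_stuffle_word:
  assumes \<mu>: "Re \<mu> > 0" and "positive u" "positive v"
  shows "zeta_trunc \<mu> M (stuffle_word \<mu> u v) = zeta_trunc_word \<mu> M u * zeta_trunc_word \<mu> M v"
  using assms(2,3)
proof (induction u arbitrary: v M rule: rev_induct)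
  case Nil
  then show ?case by simp
next
  case (snoc x u)
  note IH = snoc.IH and u = snoc.prems
  from snoc.prems(2) show ?case
  proof (induction v arbitrary: M rule: rev_induct)
    case Nil
    then show ?case by simp
  next
    case (snoc y v)
    let ?S = "\<lambda>w n. zeta_trunc_word \<mu> n w"
    have pos: "positive u" "positive v" "x \<in> letters" "y \<in> letters"
      using u snoc.prems by (auto simp: positive_singleton)
    have "?S (u @ [x]) M * ?S (v @ [y]) M
      = (\<Sum>n\<le>M. ?S u n * ?S (v @ [y]) n * letter_fun \<mu> x n)
       + (\<Sum>n\<le>M. ?S (u @ [x]) n * ?S v n * letter_fun \<mu> y n)
       - (\<Sum>n\<le>M. ?S u n * ?S v n * (letter_fun \<mu> x n * letter_fun \<mu> y n))"
      unfolding zeta_trunc_word_snoc sum_mult_sum_partial_sums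
      by (simp add: mult_ac)
    also have "\<dots> = zeta_trunc \<mu> M (stuffle_word \<mu> (u @ [x]) (v @ [y]))"
      using IH[OF pos(1) pos(2)] IH[OF pos(1) snoc.prems] snoc.IH[OF pos(2)]
      by (simp add: stuffle_word_snoc zeta_trunc.add zeta_trunc.diff zeta_trunc.scale
          zeta_trunc_conc_letter zeta_trunc_conc_odot[OF \<mu> pos(3,4)])
    finally show ?case by simp
  qed
qed

lemma zeta_trunc_stuffle:
  assumes \<mu>: "Re \<mu> > 0" and "p \<in> free_alg \<mu>" "q \<in> free_alg \<mu>"
  shows "zeta_trunc \<mu> M (stuffle \<mu> p q) = zeta_trunc \<mu> M p * zeta_trunc \<mu> M q"
proof -
  have "free_alg \<mu> \<subseteq> {q. zeta_trunc \<mu> M (stuffle \<mu> (wd u) q) = zeta_trunc \<mu> M (wd u) * zeta_trunc \<mu> M q}"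
    if "positive u" for u
    by (rule free_alg_subset)
       (auto intro!: QsubmoduleI simp: stuffle_right.add stuffle_right.scale zeta_trunc.add zeta_trunc.scale
          algebra_simps zeta_trunc_stuffle_word[OF \<mu> that])
  with assms(3) have "free_alg \<mu> \<subseteq> {p. zeta_trunc \<mu> M (stuffle \<mu> p q) = zeta_trunc \<mu> M p * zeta_trunc \<mu> M q}"
    by (intro free_alg_subset)
       (auto intro!: QsubmoduleI simp: stuffle_left.add stuffle_left.scale zeta_trunc.add zeta_trunc.scale
          algebra_simps)
  with assms(2) show ?thesis by auto
qed

section \<open>Generation of the free algebra by repeated stuffling with one letter\<close>

lemma Qsubmodule_free_alg0: "Qsubmodule \<mu> nc_scale (free_alg0 \<mu>)"
  unfolding free_alg0_def by (rule Qsubmodule_span_over[OF nc.module_axioms])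

lemma admissible_in_free_alg0: "admissible w \<Longrightarrow> wd w \<in> free_alg0 \<mu>"
  unfolding free_alg0_def by (rule span_over_base[OF nc.module_axioms]) blast

lemma special_in_free_alg0:
  "special u m m' \<Longrightarrow> wd (u @ [(1, m)]) - wd (u @ [(1, m')]) \<in> free_alg0 \<mu>"
  unfolding free_alg0_def by (rule span_over_base[OF nc.module_axioms]) blast

lemma free_alg0_subset:
  assumes "Qsubmodule \<mu> nc_scale A" "\<And>w. admissible w \<Longrightarrow> wd w \<in> A"
    "\<And>u m m'. special u m m' \<Longrightarrow> wd (u @ [(1, m)]) - wd (u @ [(1, m')]) \<in> A"
  shows "free_alg0 \<mu> \<subseteq> A"
  unfolding free_alg0_def by (rule span_over_subset[OF assms(1)]) (use assms(2,3) in auto)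

lemma free_alg0_subset_free_alg: "free_alg0 \<mu> \<subseteq> free_alg \<mu>"
  by (rule free_alg0_subset[OF Qsubmodule_free_alg])
     (auto simp: admissible_def special_def positive_singleton letters_def
        intro!: wd_in_free_alg Qsubmodule_diff[OF nc.module_axioms Qsubmodule_free_alg])

lemma conc_admissible_in_free_alg0:
  assumes "p \<in> free_alg \<mu>" "positive v" "k > 1" "m > 0"
  shows "conc p (wd (v @ [(k, m)])) \<in> free_alg0 \<mu>"
proof -
  have "free_alg \<mu> \<subseteq> {p. conc p (wd (v @ [(k, m)])) \<in> free_alg0 \<mu>}"
    by (rule free_alg_subset[OF Qsubmodule_vimage[OF conc_left.module_hom_axioms Qsubmodule_free_alg0]])
       (use assms in \<open>auto intro!: admissible_in_free_alg0 simp: admissible_def positive_singleton letters_def\<close>)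
  with assms(1) show ?thesis by auto
qed

text \<open>The degenerate case \<open>m = m'\<close> is included, so later replacements of one
  letter of weight one by another need no case distinction.\<close>

lemma conc_special_in_free_alg0:
  assumes "p \<in> free_alg \<mu>" "m > 0" "m' > 0"
  shows "conc p (wd [(1, m)]) - conc p (wd [(1, m')]) \<in> free_alg0 \<mu>"
proof (cases "m = m'")
  case True
  then show ?thesis by (simp add: Qsubmodule_zero[OF Qsubmodule_free_alg0])
next
  case False
  have "free_alg \<mu> \<subseteq> {p. conc p (wd [(1, m)] - wd [(1, m')]) \<in> free_alg0 \<mu>}"
    by (rule free_alg_subset[OF Qsubmodule_vimage[OF conc_left.module_hom_axioms Qsubmodule_free_alg0]])
       (use assms False in \<open>auto simp: conc_right.diff special_def intro!: special_in_free_alg0[unfolded One_nat_def]\<close>)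
  with assms(1) show ?thesis by (auto simp: conc_right.diff)
qed

text \<open>Since the residues of a partial fraction decomposition cancel, the two letters of weight one
  that occur in \<open>odot x y\<close> combine to a quasi-admissible difference.\<close>

lemma conc_odot_in_free_alg0:
  assumes p: "p \<in> free_alg \<mu>" and xy: "x \<in> letters" "y \<in> letters"
  shows "conc p (odot x y) \<in> free_alg0 \<mu>"
proof -
  obtain k1 m1 k2 m2 where e: "x = (k1, m1)" "y = (k2, m2)" by (metis surj_pair)
  have km: "m1 > 0" "m2 > 0" "k1 \<ge> 1" "k2 \<ge> 1" using xy by (auto simp: e letters_def)
  show ?thesis
  proof (cases "m1 = m2")
    case True
    then show ?thesis
      using conc_admissible_in_free_alg0[OF p, of "[]" "k1 + k2" m1] km by (simp add: odot_def e)
  next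
    case False
    obtain a b where ab: "pf_coeffs x y = (a, b)" by (metis surj_pair)
    have "is_partial_fraction (k1, m1) (k2, m2) a b"
      using pf_coeffs_partial_fraction[of k1 m1 k2 m2 a b] xy ab False by (simp add: e)
    from partial_fraction_residues[OF this] km have res: "b 1 = - a 1" by (simp add: eq_neg_iff_add_eq_0 add.commute)
    define g h where "g i = nc_scale (of_rat (a i)) (conc p (wd [(i, m1)]))"
      and "h j = nc_scale (of_rat (b j)) (conc p (wd [(j, m2)]))" for i j
    have "conc p (odot x y) = (\<Sum>i=1..k1. g i) + (\<Sum>j=1..k2. h j)"
      using False ab by (simp add: odot_def e conc_right.add conc_right.sum conc_right.scale g_def h_def)
    also have "\<dots> = (g 1 + h 1) + ((\<Sum>i=2..k1. g i) + (\<Sum>j=2..k2. h j))"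
      using km by (simp add: sum.atLeast_Suc_atMost numeral_2_eq_2)
    also have "g 1 + h 1 = nc_scale (of_rat (a 1)) (conc p (wd [(1, m1)]) - conc p (wd [(1, m2)]))"
      by (simp add: g_def h_def res of_rat_minus nc.scale_right_diff_distrib del: One_nat_def)
    also have "\<dots> + ((\<Sum>i=2..k1. g i) + (\<Sum>j=2..k2. h j)) \<in> free_alg0 \<mu>"
      unfolding g_def h_def
      by (intro Qsubmodule_add[OF Qsubmodule_free_alg0] Qsubmodule_sum[OF Qsubmodule_free_alg0]
          Qsubmodule_scale[OF Qsubmodule_free_alg0] Qring.rat conc_special_in_free_alg0 p km
          conc_admissible_in_free_alg0[where v = "[]", simplified]) auto
    finally show ?thesis .
  qed
qed

text \<open>There is no clause for scalars: they can be moved through the stuffle product down to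
  the base, which is closed under them. Inductions over this set thus have exactly the cases on
  which the required map is determined.\<close>

inductive_set stuffle_gen :: "complex \<Rightarrow> rat \<Rightarrow> ncpoly set" for \<mu> m where
  base: "p \<in> free_alg0 \<mu> \<Longrightarrow> p \<in> stuffle_gen \<mu> m"
| add: "p \<in> stuffle_gen \<mu> m \<Longrightarrow> q \<in> stuffle_gen \<mu> m \<Longrightarrow> p + q \<in> stuffle_gen \<mu> m"
| stuffle: "p \<in> stuffle_gen \<mu> m \<Longrightarrow> stuffle \<mu> p (wd [(1, m)]) \<in> stuffle_gen \<mu> m"

lemma Qsubmodule_stuffle_gen: "Qsubmodule \<mu> nc_scale (stuffle_gen \<mu> m)"
proof (rule QsubmoduleI)
  show "0 \<in> stuffle_gen \<mu> m"
    by (intro stuffle_gen.base Qsubmodule_zero[OF Qsubmodule_free_alg0])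
  show "nc_scale c p \<in> stuffle_gen \<mu> m" if "c \<in> Qring \<mu>" "p \<in> stuffle_gen \<mu> m" for c p
    using that(2,1)
  proof induction
    case (stuffle p)
    then show ?case
      using stuffle_gen.stuffle by (simp flip: stuffle_left.scale)
  qed (auto simp: nc.scale_right_distrib
         intro: stuffle_gen.base stuffle_gen.add Qsubmodule_scale[OF Qsubmodule_free_alg0])
qed (rule stuffle_gen.add)

definition ypow :: "rat \<Rightarrow> nat \<Rightarrow> word" where
  "ypow m n = replicate n (1, m)"

lemma ypow_0 [simp]: "ypow m 0 = []"
  by (simp add: ypow_def)

lemma ypow_Suc: "ypow m (Suc n) = ypow m n @ [(1, m)]"
  by (simp add: ypow_def replicate_append_same del: One_nat_def)

lemma positive_ypow: "m > 0 \<Longrightarrow> positive (ypow m n)"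
  by (auto simp: positive_def ypow_def letters_def)

text \<open>A filtration by the number of letters y allowed behind a quasi-admissible element; it
  makes precise the lower terms modulo which stuffling with y has leading coefficient n + 1.\<close>

definition low_part :: "complex \<Rightarrow> rat \<Rightarrow> nat \<Rightarrow> ncpoly set" where
  "low_part \<mu> m n = span_over (Qring \<mu>) nc_scale {conc p (wd (ypow m j)) | p j. p \<in> free_alg0 \<mu> \<and> j \<le> n}"

lemma Qsubmodule_low_part: "Qsubmodule \<mu> nc_scale (low_part \<mu> m n)"
  unfolding low_part_def by (rule Qsubmodule_span_over[OF nc.module_axioms])

lemma low_part_base: "p \<in> free_alg0 \<mu> \<Longrightarrow> j \<le> n \<Longrightarrow> conc p (wd (ypow m j)) \<in> low_part \<mu> m n"
  unfolding low_part_def by (rule span_over_base[OF nc.module_axioms]) blast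

lemma free_alg0_subset_low_part: "free_alg0 \<mu> \<subseteq> low_part \<mu> m n"
  using low_part_base[of _ \<mu> 0 n m] by auto

lemma conc_low_part:
  assumes "p \<in> low_part \<mu> m n"
  shows "conc p (wd [(1, m)]) \<in> low_part \<mu> m (Suc n)"
proof -
  have "low_part \<mu> m n \<subseteq> {p. conc p (wd [(1, m)]) \<in> low_part \<mu> m (Suc n)}"
    unfolding low_part_def[of \<mu> m n]
    by (rule span_over_subset[OF Qsubmodule_vimage[OF conc_left.module_hom_axioms Qsubmodule_low_part]])
       (auto simp: conc_assoc_wd simp flip: ypow_Suc[unfolded One_nat_def] intro: low_part_base)
  with assms show ?thesis by auto
qed

lemma stuffle_word_letter:
  "stuffle_word \<mu> (u @ [x]) [y]
    = conc (stuffle_word \<mu> u [y]) (wd [x]) + wd (u @ [x, y]) - nc_scale \<mu> (conc (wd u) (odot x y))"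
  using stuffle_word_snoc[of \<mu> u x "[]" y] by simp

text \<open>Both last letters are y, and merging them gives the letter \<open>(2, m)\<close>, so the
  correction term ends in an admissible way.\<close>

lemma stuffle_conc_ypow_Suc:
  "stuffle \<mu> (conc p (wd (ypow m (Suc n)))) (wd [(1, m)])
    = conc (stuffle \<mu> (conc p (wd (ypow m n))) (wd [(1, m)])) (wd [(1, m)])
      + conc p (wd (ypow m (Suc (Suc n)))) - nc_scale \<mu> (conc p (wd (ypow m n @ [(2, m)])))"
  (is "?f p = ?g p")
proof (rule module_hom_ncpoly_eqI[where f = ?f and g = ?g])
  show "module_hom nc_scale nc_scale ?f"
    by unfold_locales (simp_all add: conc_left.add conc_left.scale stuffle_left.add stuffle_left.scale)
  show "module_hom nc_scale nc_scale ?g"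
    by unfold_locales (simp_all add: conc_left.add conc_left.scale stuffle_left.add stuffle_left.scale
       nc.scale_right_distrib nc.scale_right_diff_distrib nc.scale_left_commute)
  show "?f (wd w) = ?g (wd w)" for w
    using stuffle_word_letter[of \<mu> "w @ ypow m n" "(1, m)" "(1, m)"]
    by (simp add: ypow_Suc odot_def del: One_nat_def)
qed

text \<open>In the recursion, the previous case with y appended contributes n + 1 copies of the
  leading term and the middle term one more. For n = 0, what remains after removing p y either keeps
  the last letter of p or comes from \<open>odot\<close>; both kinds stay quasi-admissible.\<close>

lemma stuffle_conc_ypow:
  assumes m: "m > 0" and "p \<in> free_alg0 \<mu>"
  shows "stuffle \<mu> (conc p (wd (ypow m n))) (wd [(1, m)])
    - nc_scale (of_nat (Suc n)) (conc p (wd (ypow m (Suc n)))) \<in> low_part \<mu> m n"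
  using assms(2)
proof (induction n)
  case 0
  let ?y = "(1, m) :: letter"
  define f where "f p = stuffle \<mu> p (wd [?y]) - conc p (wd [?y])" for p
  have f: "module_hom nc_scale nc_scale f"
    by unfold_locales (simp_all add: f_def conc_left.add conc_left.scale stuffle_left.add stuffle_left.scale
       nc.scale_right_distrib nc.scale_right_diff_distrib)
  interpret f: module_hom nc_scale nc_scale f by (rule f)
  have y: "?y \<in> letters" using m by (simp add: letters_def)
  have f_snoc: "f (wd (u @ [x])) = conc (stuffle_word \<mu> u [?y]) (wd [x]) - nc_scale \<mu> (conc (wd u) (odot x ?y))"
    for u x
    by (simp add: f_def stuffle_word_letter del: One_nat_def)
  have odot: "nc_scale \<mu> (conc (wd u) (odot x ?y)) \<in> free_alg0 \<mu>" if "positive u" "x \<in> letters" for u x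
    by (intro Qsubmodule_scale[OF Qsubmodule_free_alg0] Qring.gen conc_odot_in_free_alg0 wd_in_free_alg that y)
  have st: "stuffle_word \<mu> u [?y] \<in> free_alg \<mu>" if "positive u" for u
    using that y by (intro stuffle_word_in_free_alg) (auto simp: positive_singleton)
  have "free_alg0 \<mu> \<subseteq> {p. f p \<in> free_alg0 \<mu>}"
  proof (rule free_alg0_subset[OF Qsubmodule_vimage[OF f Qsubmodule_free_alg0]])
    fix w assume w: "admissible w"
    show "wd w \<in> {p. f p \<in> free_alg0 \<mu>}"
    proof (cases w rule: rev_cases)
      case Nil
      then show ?thesis by (simp add: f_def Qsubmodule_zero[OF Qsubmodule_free_alg0])
    next
      case (snoc u x)
      with w have "positive u" "fst x > 1" "snd x > 0" "x \<in> letters"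
        by (auto simp: admissible_def positive_singleton letters_def)
      then show ?thesis
        using conc_admissible_in_free_alg0[OF st, of u "[]" "fst x" "snd x"] odot[of u x]
        by (simp add: snoc f_snoc Qsubmodule_diff[OF nc.module_axioms Qsubmodule_free_alg0] del: One_nat_def)
    qed
  next
    fix u m1 m2 assume s: "special u m1 m2"
    let ?d = "\<lambda>m'. nc_scale \<mu> (conc (wd u) (odot (1, m') ?y))"
    let ?c = "\<lambda>m'. conc (stuffle_word \<mu> u [?y]) (wd [(1, m')])"
    \<comment> \<open>The two \<open>?c\<close> terms share a prefix and differ in a last letter of
      weight one, so only their difference is quasi-admissible; each \<open>?d\<close> term is so by
      itself.\<close>
    have "?c m1 - ?c m2 - (?d m1 - ?d m2) \<in> free_alg0 \<mu>"
      using s by (intro Qsubmodule_diff[OF nc.module_axioms Qsubmodule_free_alg0] conc_special_in_free_alg0 st odot)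
        (auto simp: special_def letters_def)
    then show "wd (u @ [(1, m1)]) - wd (u @ [(1, m2)]) \<in> {p. f p \<in> free_alg0 \<mu>}"
      by (simp add: f.diff f_snoc algebra_simps del: One_nat_def)
  qed
  with 0 have "f p \<in> low_part \<mu> m 0"
    using free_alg0_subset_low_part by blast
  then show ?case by (simp add: f_def ypow_Suc del: One_nat_def)
next
  case (Suc n)
  let ?y = "wd [(1, m)]"
  define r where "r = stuffle \<mu> (conc p (wd (ypow m n))) ?y
    - nc_scale (of_nat (Suc n)) (conc p (wd (ypow m (Suc n))))"
  have r: "r \<in> low_part \<mu> m n" using Suc by (simp add: r_def)
  have "conc r ?y = conc (stuffle \<mu> (conc p (wd (ypow m n))) ?y) ?y
      - nc_scale (of_nat (Suc n)) (conc p (wd (ypow m (Suc (Suc n)))))"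
    by (simp add: r_def conc_left.diff conc_left.scale conc_assoc_wd ypow_Suc del: of_nat_Suc One_nat_def)
  then have "stuffle \<mu> (conc p (wd (ypow m (Suc n)))) ?y
      - nc_scale (of_nat (Suc (Suc n))) (conc p (wd (ypow m (Suc (Suc n)))))
    = conc r ?y - nc_scale \<mu> (conc p (wd (ypow m n @ [(2, m)])))"
    unfolding stuffle_conc_ypow_Suc of_nat_Suc[of "Suc n"] nc.scale_left_distrib by simp
  also have "\<dots> \<in> low_part \<mu> m (Suc n)"
  proof (rule Qsubmodule_diff[OF nc.module_axioms Qsubmodule_low_part])
    show "conc r ?y \<in> low_part \<mu> m (Suc n)" by (rule conc_low_part[OF r])
    have "conc p (wd (ypow m n @ [(2, m)])) \<in> free_alg0 \<mu>"
      using Suc.prems free_alg0_subset_free_alg m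
      by (intro conc_admissible_in_free_alg0 positive_ypow) auto
    then show "nc_scale \<mu> (conc p (wd (ypow m n @ [(2, m)]))) \<in> low_part \<mu> m (Suc n)"
      using free_alg0_subset_low_part by (intro Qsubmodule_scale[OF Qsubmodule_low_part] Qring.gen) blast
  qed
  finally show ?case .
qed

text \<open>Solves the preceding congruence for its leading term. The division by n + 1 stays within
  Q[\<mu>], which contains all rationals.\<close>

lemma low_part_subset_stuffle_gen:
  assumes m: "m > 0"
  shows "low_part \<mu> m n \<subseteq> stuffle_gen \<mu> m"
proof (induction n)
  case 0
  show ?case
    unfolding low_part_def by (rule span_over_subset[OF Qsubmodule_stuffle_gen]) (auto intro: stuffle_gen.base)
next
  case (Suc n)
  have "conc p (wd (ypow m (Suc n))) \<in> stuffle_gen \<mu> m" if p: "p \<in> free_alg0 \<mu>" for p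
  proof -
    let ?q = "conc p (wd (ypow m (Suc n)))"
    let ?s = "stuffle \<mu> (conc p (wd (ypow m n))) (wd [(1, m)])"
    have "?s \<in> stuffle_gen \<mu> m"
      using low_part_base[OF p, of n n m] Suc by (intro stuffle_gen.stuffle) auto
    moreover have "?s - nc_scale (of_nat (Suc n)) ?q \<in> stuffle_gen \<mu> m"
      using stuffle_conc_ypow[OF m p, of n] Suc by blast
    ultimately have "?s - (?s - nc_scale (of_nat (Suc n)) ?q) \<in> stuffle_gen \<mu> m"
      by (rule Qsubmodule_diff[OF nc.module_axioms Qsubmodule_stuffle_gen])
    then have "nc_scale (of_nat (Suc n)) ?q \<in> stuffle_gen \<mu> m" by simp
    from Qsubmodule_scale[OF Qsubmodule_stuffle_gen Qring.rat this]
    have "nc_scale (of_rat (1 / of_nat (Suc n))) (nc_scale (of_nat (Suc n)) ?q) \<in> stuffle_gen \<mu> m" .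
    moreover have "of_rat (1 / of_nat (Suc n)) * of_nat (Suc n) = (1 :: complex)"
      by (simp add: of_rat_divide of_rat_add del: of_nat_Suc)
    ultimately show ?thesis by (simp only: nc.scale_scale nc.scale_one)
  qed
  moreover have "conc p (wd (ypow m j)) \<in> stuffle_gen \<mu> m" if "p \<in> free_alg0 \<mu>" "j \<le> n" for p j
    using low_part_base[OF that, of m] Suc by blast
  ultimately show ?case
    unfolding low_part_def
    by (intro span_over_subset[OF Qsubmodule_stuffle_gen]) (auto simp: le_Suc_eq)
qed

text \<open>Words are read from the right behind a block of n letters y, with n arbitrary. A letter
  of weight above one ends an admissible prefix; a letter of weight one is exchanged for y at the
  cost of a quasi-admissible difference, and this y joins the block.\<close>

lemma free_alg_subset_stuffle_gen:
  assumes m: "m > 0"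
  shows "free_alg \<mu> \<subseteq> stuffle_gen \<mu> m"
proof (rule free_alg_subset[OF Qsubmodule_stuffle_gen])
  have low: "conc p (wd (ypow m n)) \<in> stuffle_gen \<mu> m" if "p \<in> free_alg0 \<mu>" for p n
    using low_part_base[OF that, of n n m] low_part_subset_stuffle_gen[OF m] by blast
  have "wd (w @ ypow m n) \<in> stuffle_gen \<mu> m" if "positive w" for w n
    using that
  proof (induction w arbitrary: n rule: rev_induct)
    case Nil
    then show ?case
      using low[OF admissible_in_free_alg0[of "[]"], of n] by (simp add: admissible_def)
  next
    case (snoc x u)
    obtain k m' where x: "x = (k, m')" by (metis surj_pair)
    have u: "positive u" and km: "k \<ge> 1" "m' > 0"
      using snoc.prems by (auto simp: x positive_singleton letters_def)
    show ?case
    proof (cases "k = 1")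
      case False
      then have "admissible (u @ [x])"
        using snoc.prems km by (auto simp: admissible_def x)
      from low[OF admissible_in_free_alg0[OF this], of n] show ?thesis by simp
    next
      case True
      have "(1, m) # ypow m n = ypow m (Suc n)" by (simp add: ypow_def)
      with snoc.IH[OF u, of "Suc n"] have u_y: "wd (u @ [(1, m)] @ ypow m n) \<in> stuffle_gen \<mu> m" by simp
      have "conc (wd u) (wd [(1, m')]) - conc (wd u) (wd [(1, m)]) \<in> free_alg0 \<mu>"
        by (intro conc_special_in_free_alg0 wd_in_free_alg u m km)
      from stuffle_gen.add[OF low[OF this, of n] u_y] show ?thesis
        by (simp add: x True conc_left.diff)
    qed
  qed
  from this[of _ 0] show "wd w \<in> stuffle_gen \<mu> m" if "positive w" for w
    using that by simp
qed

section \<open>Asymptotics of nested sums\<close>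

text \<open>The two shifts make the scale at least 1 at every n, including 0, so its powers increase
  with the exponent and bounds hold for all n instead of eventually.\<close>

definition log_scale :: "nat \<Rightarrow> real" where
  "log_scale n = 1 + ln (real n + 1)"

lemma log_scale_ge_1: "log_scale n \<ge> 1"
  by (simp add: log_scale_def)

lemma log_scale_nonneg: "log_scale n \<ge> 0"
  using log_scale_ge_1[of n] by simp

lemma log_scale_mono: "n \<le> N \<Longrightarrow> log_scale n \<le> log_scale N"
  by (simp add: log_scale_def)

lemma log_scale_pow_mono: "n \<le> N \<Longrightarrow> log_scale n ^ j \<le> log_scale N ^ j"
  using log_scale_mono log_scale_ge_1[of n] by (intro power_mono) auto

lemma sum_inverse_le_log_scale: "(\<Sum>i\<le>n. 1 / (real i + 1)) \<le> log_scale n"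
proof (induction n)
  case 0
  then show ?case by (simp add: log_scale_def)
next
  case (Suc n)
  \<comment> \<open>The bound ln t \<le> t - 1 at t = (n + 1) / (n + 2) compares one harmonic term
    with one increment of the logarithm.\<close>
  have "ln ((real n + 1) / (real n + 2)) \<le> (real n + 1) / (real n + 2) - 1"
    by (rule ln_le_minus_one) simp
  also have "\<dots> = - (1 / (real n + 2))" by (simp add: field_simps)
  finally have "ln (real n + 1) - ln (real n + 2) \<le> - (1 / (real n + 2))"
    by (simp add: ln_div)
  with Suc show ?case by (simp add: log_scale_def add.commute)
qed

text \<open>The errors must decay faster than every power of the logarithm: products of truncations
  multiply them by powers of \<open>H\<^sub>M\<close>.\<close>

definition log_negligible :: "(nat \<Rightarrow> complex) \<Rightarrow> bool" where
  "log_negligible g \<longleftrightarrow> (\<forall>j. (\<lambda>n. log_scale n ^ j * norm (g n)) \<longlonglongrightarrow> 0)"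

definition log_bounded :: "(nat \<Rightarrow> complex) \<Rightarrow> bool" where
  "log_bounded h \<longleftrightarrow> (\<exists>C j. \<forall>n. norm (h n) \<le> C * log_scale n ^ j)"

lemma log_negligible_zero [simp]: "log_negligible (\<lambda>_. 0)"
  by (simp add: log_negligible_def)

lemma log_negligible_imp_tendsto: "log_negligible g \<Longrightarrow> g \<longlonglongrightarrow> 0"
  unfolding log_negligible_def by (drule spec[of _ 0]) (simp add: tendsto_norm_zero_iff)

lemma log_negligible_le:
  assumes "log_negligible g" "\<And>n. norm (h n) \<le> norm (g n)"
  shows "log_negligible h"
  unfolding log_negligible_def
proof
  fix j
  show "(\<lambda>n. log_scale n ^ j * norm (h n)) \<longlonglongrightarrow> 0"
  proof (rule Lim_null_comparison)
    show "(\<lambda>n. log_scale n ^ j * norm (g n)) \<longlonglongrightarrow> 0" using assms(1) by (simp add: log_negligible_def)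
    show "\<forall>\<^sub>F n in sequentially. norm (log_scale n ^ j * norm (h n)) \<le> log_scale n ^ j * norm (g n)"
      using assms(2) log_scale_ge_1
      by (intro always_eventually allI) (auto simp: abs_mult log_scale_nonneg intro!: mult_mono)
  qed
qed

lemma log_negligible_add:
  assumes "log_negligible g" "log_negligible h"
  shows "log_negligible (\<lambda>n. g n + h n)"
  unfolding log_negligible_def
proof
  fix j
  show "(\<lambda>n. log_scale n ^ j * norm (g n + h n)) \<longlonglongrightarrow> 0"
  proof (rule Lim_null_comparison)
    have "(\<lambda>n. log_scale n ^ j * norm (g n) + log_scale n ^ j * norm (h n)) \<longlonglongrightarrow> 0 + 0"
      using assms by (intro tendsto_add) (auto simp: log_negligible_def)
    then show "(\<lambda>n. log_scale n ^ j * norm (g n) + log_scale n ^ j * norm (h n)) \<longlonglongrightarrow> 0" by simp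
    have "norm (log_scale n ^ j * norm (g n + h n)) \<le> log_scale n ^ j * norm (g n) + log_scale n ^ j * norm (h n)" for n
      using log_scale_ge_1[of n] norm_triangle_ineq[of "g n" "h n"]
      by (simp add: abs_mult flip: distrib_left)
    then show "\<forall>\<^sub>F n in sequentially. norm (log_scale n ^ j * norm (g n + h n))
        \<le> log_scale n ^ j * norm (g n) + log_scale n ^ j * norm (h n)" by simp
  qed
qed

lemma log_negligible_mult:
  assumes "log_negligible g" "log_bounded h"
  shows "log_negligible (\<lambda>n. h n * g n)"
  unfolding log_negligible_def
proof
  fix j
  obtain C i where C: "\<And>n. norm (h n) \<le> C * log_scale n ^ i"
    using assms(2) by (auto simp: log_bounded_def)
  show "(\<lambda>n. log_scale n ^ j * norm (h n * g n)) \<longlonglongrightarrow> 0"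
  proof (rule Lim_null_comparison)
    have "(\<lambda>n. C * (log_scale n ^ (j + i) * norm (g n))) \<longlonglongrightarrow> C * 0"
      using assms(1) by (intro tendsto_mult tendsto_const) (auto simp: log_negligible_def)
    then show "(\<lambda>n. C * (log_scale n ^ (j + i) * norm (g n))) \<longlonglongrightarrow> 0" by simp
    have "norm (log_scale n ^ j * norm (h n * g n)) \<le> C * (log_scale n ^ (j + i) * norm (g n))" for n
    proof -
      have "norm (log_scale n ^ j * norm (h n * g n)) = log_scale n ^ j * norm (g n) * norm (h n)"
        using log_scale_ge_1[of n] by (simp add: abs_mult norm_mult mult_ac)
      also have "\<dots> \<le> log_scale n ^ j * norm (g n) * (C * log_scale n ^ i)"
        using log_scale_ge_1[of n] by (intro mult_left_mono C) auto
      finally show ?thesis by (simp add: power_add mult_ac)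
    qed
    then show "\<forall>\<^sub>F n in sequentially. norm (log_scale n ^ j * norm (h n * g n))
        \<le> C * (log_scale n ^ (j + i) * norm (g n))" by simp
  qed
qed

lemma log_bounded_const [simp]: "log_bounded (\<lambda>_. c)"
  unfolding log_bounded_def by (rule exI[of _ "norm c"], rule exI[of _ 0]) simp

lemma log_bounded_mult:
  assumes "log_bounded g" "log_bounded h"
  shows "log_bounded (\<lambda>n. g n * h n)"
proof -
  obtain C i D j where *: "\<And>n. norm (g n) \<le> C * log_scale n ^ i" "\<And>n. norm (h n) \<le> D * log_scale n ^ j"
    using assms by (auto simp: log_bounded_def)
  have "norm (g n * h n) \<le> (C * D) * log_scale n ^ (i + j)" for n
  proof -
    have "norm (g n * h n) \<le> (C * log_scale n ^ i) * (D * log_scale n ^ j)"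
      unfolding norm_mult using *[of n] by (intro mult_mono) (auto intro: order_trans[OF norm_ge_zero])
    then show ?thesis by (simp add: power_add mult_ac)
  qed
  then show ?thesis unfolding log_bounded_def by blast
qed

lemma log_bounded_add:
  assumes "log_bounded g" "log_bounded h"
  shows "log_bounded (\<lambda>n. g n + h n)"
proof -
  obtain C i D j where *: "\<And>n. norm (g n) \<le> C * log_scale n ^ i" "\<And>n. norm (h n) \<le> D * log_scale n ^ j"
    using assms by (auto simp: log_bounded_def)
  have "norm (g n + h n) \<le> (\<bar>C\<bar> + \<bar>D\<bar>) * log_scale n ^ (i + j)" for n
  proof -
    have "norm (g n + h n) \<le> C * log_scale n ^ i + D * log_scale n ^ j"
      using *[of n] norm_triangle_ineq[of "g n" "h n"] by linarith
    also have "\<dots> \<le> \<bar>C\<bar> * log_scale n ^ (i + j) + \<bar>D\<bar> * log_scale n ^ (i + j)"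
      using log_scale_ge_1[of n] by (intro add_mono mult_mono power_increasing) auto
    finally show ?thesis by (simp add: distrib_right)
  qed
  then show ?thesis unfolding log_bounded_def by blast
qed

lemma log_bounded_poly: "log_bounded h \<Longrightarrow> log_bounded (\<lambda>n. poly P (h n))"
  by (induction P) (auto intro!: log_bounded_add log_bounded_mult)

lemma log_negligible_uminus: "log_negligible g \<Longrightarrow> log_negligible (\<lambda>n. - g n)"
  by (erule log_negligible_le) simp

lemma log_negligible_imp_log_bounded:
  assumes "log_negligible g"
  shows "log_bounded g"
proof -
  have "Bseq g"
    using log_negligible_imp_tendsto[OF assms] by (intro convergent_imp_Bseq convergentI)
  then obtain C where "\<And>n. norm (g n) \<le> C" by (auto simp: Bseq_def)
  then show ?thesis unfolding log_bounded_def by (intro exI[of _ C] exI[of _ 0]) simp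
qed

lemma summable_log_scale_over_square: "summable (\<lambda>n. log_scale n ^ j / (real n + 1)\<^sup>2)"
proof (rule summable_comparison_test_bigo)
  \<comment> \<open>Half a power of n is given up to absorb an arbitrary power of the
    logarithm.\<close>
  have "summable (\<lambda>n. real n powr (-3/2))" by (subst summable_real_powr_iff) simp
  then show "summable (\<lambda>n. norm (real n powr (-3/2)))" by simp
  show "(\<lambda>n. log_scale n ^ j / (real n + 1)\<^sup>2) \<in> O(\<lambda>n. real n powr (-3/2))"
    unfolding log_scale_def by real_asymp
qed

lemma summable_log_weighted:
  assumes "\<And>n. norm (a n) \<le> C * log_scale n ^ i / (real n + 1)\<^sup>2"
  shows "summable (\<lambda>n. log_scale n ^ j * norm (a n))"
proof (rule summable_comparison_test')
  show "summable (\<lambda>n. C * (log_scale n ^ (j + i) / (real n + 1)\<^sup>2))"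
    by (intro summable_mult summable_log_scale_over_square)
  show "norm (log_scale n ^ j * norm (a n)) \<le> C * (log_scale n ^ (j + i) / (real n + 1)\<^sup>2)" if "n \<ge> 0" for n
    using mult_left_mono[OF assms[of n], of "log_scale n ^ j"] log_scale_ge_1[of n]
    by (simp add: abs_mult power_add mult_ac)
qed

text \<open>Beyond \<open>M\<close> the scale is at least its value at \<open>M\<close>, so the
  factor \<open>log_scale M ^ j\<close> can be moved inside the tail and replaced by the scale at
  the running index. What results is the tail of a convergent series.\<close>

lemma log_negligible_tail:
  fixes a :: "nat \<Rightarrow> complex"
  assumes a: "\<And>n. norm (a n) \<le> C * log_scale n ^ i / (real n + 1)\<^sup>2"
  shows "log_negligible (\<lambda>M. (\<Sum>n\<le>M. a n) - suminf a)"
  unfolding log_negligible_def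
proof
  fix j
  let ?b = "\<lambda>n. log_scale n ^ j * norm (a n)"
  have b: "summable ?b" by (rule summable_log_weighted[OF a])
  have na: "summable (\<lambda>n. norm (a n))" using summable_log_weighted[OF a, of 0] by simp
  then have sa: "summable a" by (rule summable_norm_cancel)
  show "(\<lambda>M. log_scale M ^ j * norm ((\<Sum>n\<le>M. a n) - suminf a)) \<longlonglongrightarrow> 0"
  proof (rule Lim_null_comparison)
    show "(\<lambda>M. suminf (\<lambda>n. ?b (n + Suc M))) \<longlonglongrightarrow> 0"
      using suminf_exist_split2[OF b] by (rule LIMSEQ_Suc)
    have "norm (log_scale M ^ j * norm ((\<Sum>n\<le>M. a n) - suminf a)) \<le> suminf (\<lambda>n. ?b (n + Suc M))" for M
    proof -
      have "norm ((\<Sum>n\<le>M. a n) - suminf a) = norm (suminf (\<lambda>n. a (n + Suc M)))"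
        using suminf_minus_initial_segment[OF sa, of "Suc M"]
        by (simp add: lessThan_Suc_atMost norm_minus_commute)
      also have "\<dots> \<le> suminf (\<lambda>n. norm (a (n + Suc M)))"
        by (rule summable_norm) (use na in \<open>subst summable_iff_shift\<close>)
      finally have "norm (log_scale M ^ j * norm ((\<Sum>n\<le>M. a n) - suminf a))
          \<le> log_scale M ^ j * suminf (\<lambda>n. norm (a (n + Suc M)))"
        using log_scale_ge_1[of M] by (simp add: abs_mult)
      also have "\<dots> = suminf (\<lambda>n. log_scale M ^ j * norm (a (n + Suc M)))"
        by (rule suminf_mult[symmetric]) (use na in \<open>subst summable_iff_shift\<close>)
      also have "\<dots> \<le> suminf (\<lambda>n. ?b (n + Suc M))"
      proof (rule suminf_le)
        show "log_scale M ^ j * norm (a (n + Suc M)) \<le> ?b (n + Suc M)" for n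
          by (intro mult_right_mono log_scale_pow_mono) auto
        show "summable (\<lambda>n. log_scale M ^ j * norm (a (n + Suc M)))"
          by (rule summable_mult) (use na in \<open>subst summable_iff_shift\<close>)
        show "summable (\<lambda>n. ?b (n + Suc M))"
          using b by (subst summable_iff_shift)
      qed
      finally show ?thesis .
    qed
    then show "\<forall>\<^sub>F M in sequentially. norm (log_scale M ^ j * norm ((\<Sum>n\<le>M. a n) - suminf a))
        \<le> suminf (\<lambda>n. ?b (n + Suc M))" by simp
  qed
qed

section \<open>Growth and convergence of nested sums\<close>

abbreviation norms :: "(nat \<Rightarrow> complex) list \<Rightarrow> (nat \<Rightarrow> real) list" where
  "norms fs \<equiv> map (\<lambda>f n. norm (f n)) fs"

lemma norm_nested_sum_le: "norm (nested_sum fs M) \<le> nested_sum (norms fs) M"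
  unfolding nested_sum_def length_map
  by (rule order_trans[OF norm_sum]) (auto intro!: sum_mono simp: prod_norm)

lemma nested_sum_norms_nonneg: "nested_sum (norms fs) M \<ge> 0"
  using norm_nested_sum_le[of fs M] norm_ge_zero order_trans by blast

text \<open>Each summation against a weight of size 1 / n costs at most one factor of the
  logarithm.\<close>

lemma nested_sum_norms_bound:
  assumes "\<And>f. f \<in> set fs \<Longrightarrow> \<exists>C. \<forall>n. norm (f n) \<le> C / (real n + 1)"
  shows "\<exists>C. \<forall>n. nested_sum (norms fs) n \<le> C * log_scale n ^ length fs"
  using assms
proof (induction fs rule: rev_induct)
  case Nil
  show ?case by (rule exI[of _ 1]) simp
next
  case (snoc f fs)
  obtain C where C: "\<And>n. nested_sum (norms fs) n \<le> C * log_scale n ^ length fs"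
    using snoc by auto
  obtain D where D: "\<And>n. norm (f n) \<le> D / (real n + 1)"
    using snoc.prems[of f] by auto
  \<comment> \<open>The constants are nonnegative because their bounds hold at n = 0, where the
    scale equals 1.\<close>
  have "0 \<le> C * log_scale 0 ^ length fs"
    using C[of 0] nested_sum_norms_nonneg[of fs 0] by simp
  then have C0: "C \<ge> 0" by (simp add: log_scale_def)
  have D0: "D \<ge> 0" using order_trans[OF norm_ge_zero D[of 0]] by simp
  have "nested_sum (norms (fs @ [f])) M \<le> (C * D) * log_scale M ^ length (fs @ [f])" for M
  proof -
    have "nested_sum (norms (fs @ [f])) M = (\<Sum>n\<le>M. nested_sum (norms fs) n * norm (f n))"
      by (simp add: nested_sum_snoc)
    also have "\<dots> \<le> (\<Sum>n\<le>M. (C * log_scale M ^ length fs) * (D / (real n + 1)))"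
    proof (rule sum_mono, rule mult_mono)
      fix n assume "n \<in> {..M}"
      then have "C * log_scale n ^ length fs \<le> C * log_scale M ^ length fs"
        using C0 by (intro mult_left_mono log_scale_pow_mono) auto
      with C[of n] show "nested_sum (norms fs) n \<le> C * log_scale M ^ length fs" by linarith
    qed (use D C0 log_scale_ge_1[of M] in auto)
    also have "\<dots> = (C * D) * log_scale M ^ length fs * (\<Sum>n\<le>M. 1 / (real n + 1))"
      by (simp add: sum_distrib_left mult_ac)
    also have "\<dots> \<le> (C * D) * log_scale M ^ length fs * log_scale M"
      using C0 D0 log_scale_ge_1[of M] by (intro mult_left_mono sum_inverse_le_log_scale) auto
    finally show ?thesis by (simp add: mult_ac)
  qed
  then show ?case by blast
qed

text \<open>Truncations are cofinal among the finite sets of tuples; this links the unordered sums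
  defining the zeta values to the limit in M.\<close>

lemma filterlim_truncated_tuples:
  "filterlim (\<lambda>M. {ns. ns \<in> sorted_tuples r \<and> set ns \<subseteq> {..M}}) (finite_subsets_at_top (sorted_tuples r)) sequentially"
  unfolding filterlim_finite_subsets_at_top
proof (intro allI impI)
  fix X assume X: "finite X \<and> X \<subseteq> sorted_tuples r"
  \<comment> \<open>The inserted 0 keeps the maximum defined when the tuples of \<open>X\<close>
    have no entries.\<close>
  define N where "N = Max (insert 0 (\<Union>(set ` X)))"
  have N: "set ns \<subseteq> {..N}" if "ns \<in> X" for ns
    using X that unfolding N_def by (auto intro!: Max_ge)
  show "\<forall>\<^sub>F M in sequentially. finite {ns \<in> sorted_tuples r. set ns \<subseteq> {..M}} \<and>
      X \<subseteq> {ns \<in> sorted_tuples r. set ns \<subseteq> {..M}} \<and> {ns \<in> sorted_tuples r. set ns \<subseteq> {..M}} \<subseteq> sorted_tuples r"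
    using eventually_ge_at_top[of N]
  proof eventually_elim
    case (elim M)
    then show ?case using X N finite_truncated_tuples[of r M] by fastforce
  qed
qed

text \<open>A last weight of size 1 / n^2 gives absolute convergence, so the unordered sum equals
  the series over the last index. Its terms are powers of the logarithm over n^2, and the tail
  estimate applies. Admissible words and the kernel of \<open>D_mu\<close> are both of this
  form.\<close>

lemma nested_sum_log_negligible_tail:
  assumes fs: "\<And>f. f \<in> set fs \<Longrightarrow> \<exists>C. \<forall>n. norm (f n) \<le> C / (real n + 1)"
    and t: "\<And>n. norm (t n) \<le> D / (real n + 1)\<^sup>2"
  shows "log_negligible (\<lambda>M. nested_sum (fs @ [t]) M
    - (\<Sum>\<^sub>\<infinity>ns\<in>sorted_tuples (Suc (length fs)). \<Prod>i<Suc (length fs). ((fs @ [t]) ! i) (ns ! i)))"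
proof -
  let ?r = "Suc (length fs)"
  let ?F = "\<lambda>ns. \<Prod>i<?r. ((fs @ [t]) ! i) (ns ! i)"
  let ?T = "\<lambda>M. {ns. ns \<in> sorted_tuples ?r \<and> set ns \<subseteq> {..M}}"
  obtain C where C: "\<And>n. nested_sum (norms fs) n \<le> C * log_scale n ^ length fs"
    using nested_sum_norms_bound[OF fs] by blast
  define b where "b n = nested_sum (norms fs) n * norm (t n)" for n
  define a where "a n = nested_sum fs n * t n" for n
  have b0: "b n \<ge> 0" for n
    by (simp add: b_def nested_sum_norms_nonneg)
  have b: "norm (b n) \<le> (C * D) * log_scale n ^ length fs / (real n + 1)\<^sup>2" for n
  proof -
    have "b n \<le> (C * log_scale n ^ length fs) * (D / (real n + 1)\<^sup>2)"
      unfolding b_def using C[of n] t[of n] nested_sum_norms_nonneg[of fs n]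
      by (intro mult_mono) auto
    with b0[of n] show ?thesis by (simp add: mult_ac)
  qed
  have a: "norm (a n) \<le> (C * D) * log_scale n ^ length fs / (real n + 1)\<^sup>2" for n
  proof -
    have "norm (a n) \<le> b n"
      unfolding a_def b_def norm_mult by (intro mult_right_mono norm_nested_sum_le) auto
    with b[of n] b0[of n] show ?thesis by simp
  qed
  have sb: "summable b"
    using summable_log_weighted[OF b, of 0] b0 by simp
  have bound: "(\<Sum>ns\<in>X. norm (?F ns)) \<le> suminf b" if X: "finite X" "X \<subseteq> sorted_tuples ?r" for X
  proof -
    define N where "N = Max (insert 0 (\<Union>(set ` X)))"
    have N: "X \<subseteq> ?T N"
      using X unfolding N_def by (auto intro!: Max_ge)
    have "(\<Sum>ns\<in>X. norm (?F ns)) \<le> (\<Sum>ns\<in>?T N. norm (?F ns))"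
      by (rule sum_mono2[OF finite_truncated_tuples N]) auto
    also have "\<dots> = nested_sum (norms (fs @ [t])) N"
      unfolding nested_sum_def length_map length_append_singleton
      by (rule sum.cong) (auto simp: nth_append norm_mult prod_norm)
    also have "\<dots> = (\<Sum>n\<le>N. b n)"
      by (simp add: nested_sum_snoc b_def)
    also have "\<dots> \<le> suminf b"
      by (rule sum_le_suminf[OF sb]) (use b0 in auto)
    finally show ?thesis .
  qed
  have "(\<lambda>ns. norm (?F ns)) summable_on sorted_tuples ?r"
    by (rule nonneg_bdd_above_summable_on) (auto intro!: bdd_aboveI[of _ "suminf b"] bound simp del: prod.lessThan_Suc)
  then have "?F summable_on sorted_tuples ?r"
    by (rule abs_summable_summable)
  then have "(?F has_sum infsum ?F (sorted_tuples ?r)) (sorted_tuples ?r)"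
    by (rule has_sum_infsum)
  then have "(\<lambda>M. sum ?F (?T M)) \<longlonglongrightarrow> infsum ?F (sorted_tuples ?r)"
    unfolding has_sum_def by (rule filterlim_compose[OF _ filterlim_truncated_tuples])
  moreover have sum_a: "sum ?F (?T M) = (\<Sum>n\<le>M. a n)" for M
    using nested_sum_snoc[of fs t M] by (simp add: nested_sum_def a_def)
  ultimately have "(\<lambda>M. \<Sum>n\<le>M. a n) \<longlonglongrightarrow> infsum ?F (sorted_tuples ?r)" by simp
  moreover have "summable a"
    using summable_log_weighted[OF a, of 0] by (simp add: summable_norm_cancel)
  then have "(\<lambda>M. \<Sum>n\<le>M. a n) \<longlonglongrightarrow> suminf a"
    by (rule summable_LIMSEQ')
  ultimately have "infsum ?F (sorted_tuples ?r) = suminf a"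
    using LIMSEQ_unique by blast
  with log_negligible_tail[OF a] show ?thesis
    by (simp only: nested_sum_snoc a_def[symmetric])
qed

section \<open>Asymptotics of truncated zeta values\<close>

lemma denominator_lower_bound:
  assumes "Re \<mu> > 0" "m > 0"
  shows "\<exists>c>0. \<forall>n. c * (real n + 1) \<le> norm (of_nat n * \<mu> + of_rat m)"
proof (intro exI conjI allI)
  \<comment> \<open>The real part of n \<mu> + m is n Re \<mu> + m, and each of Re \<mu> and m is at
    least this minimum.\<close>
  let ?c = "min (Re \<mu>) (of_rat m)"
  show "?c > 0" using assms by simp
  fix n
  have "?c * (real n + 1) = real n * ?c + ?c" by (simp add: algebra_simps)
  also have "\<dots> \<le> real n * Re \<mu> + of_rat m" by (intro add_mono mult_left_mono) auto
  also have "\<dots> = Re (of_nat n * \<mu> + of_rat m)" by (simp add: complex_of_rat_eq)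
  also have "\<dots> \<le> norm (of_nat n * \<mu> + of_rat m)" by (rule complex_Re_le_cmod)
  finally show "?c * (real n + 1) \<le> norm (of_nat n * \<mu> + of_rat m)" .
qed

text \<open>The exponent \<open>j\<close> is left free: 1 is used for inner letters of any weight, 2
  for the last letter of an admissible word.\<close>

lemma letter_fun_bound:
  assumes "Re \<mu> > 0" "snd x > 0" "j \<le> fst x"
  shows "\<exists>C. \<forall>n. norm (letter_fun \<mu> x n) \<le> C / (real n + 1) ^ j"
proof -
  obtain c where c: "c > 0" "\<And>n. c * (real n + 1) \<le> norm (of_nat n * \<mu> + of_rat (snd x))"
    using denominator_lower_bound[OF assms(1,2)] by blast
  have "norm (letter_fun \<mu> x n) \<le> norm \<mu> / c ^ fst x / (real n + 1) ^ j" for n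
  proof -
    have "c ^ fst x * (real n + 1) ^ j \<le> c ^ fst x * (real n + 1) ^ fst x"
      using c(1) assms(3) by (intro mult_left_mono power_increasing) auto
    also have "\<dots> \<le> norm (of_nat n * \<mu> + of_rat (snd x)) ^ fst x"
      unfolding power_mult_distrib[symmetric] using c by (intro power_mono) auto
    finally have "norm \<mu> / norm (of_nat n * \<mu> + of_rat (snd x)) ^ fst x \<le> norm \<mu> / (c ^ fst x * (real n + 1) ^ j)"
      using c(1) by (intro divide_left_mono mult_pos_pos) (auto intro: less_le_trans[rotated])
    then show ?thesis by (simp add: letter_fun_def norm_divide norm_power)
  qed
  then show ?thesis by blast
qed

lemma letter_fun_bound_word:
  assumes "Re \<mu> > 0" "positive w" "f \<in> set (map (letter_fun \<mu>) w)"
  shows "\<exists>C. \<forall>n. norm (f n) \<le> C / (real n + 1)"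
proof -
  obtain x where "f = letter_fun \<mu> x" "x \<in> letters"
    using assms(2,3) by (auto simp: positive_def)
  then show ?thesis
    using letter_fun_bound[OF assms(1), of x 1] by (auto simp: letters_def)
qed

lemma log_bounded_zeta_trunc_word:
  assumes "Re \<mu> > 0" "positive w"
  shows "log_bounded (\<lambda>M. zeta_trunc_word \<mu> M w)"
proof -
  obtain C where "\<And>n. nested_sum (norms (map (letter_fun \<mu>) w)) n \<le> C * log_scale n ^ length w"
    using nested_sum_norms_bound[of "map (letter_fun \<mu>) w", OF letter_fun_bound_word[OF assms]]
    unfolding length_map by blast
  then have "norm (zeta_trunc_word \<mu> n w) \<le> C * log_scale n ^ length w" for n
    using order_trans[OF norm_nested_sum_le] by (auto simp: zeta_trunc_word_nested_sum)
  then show ?thesis unfolding log_bounded_def by blast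
qed

lemma zeta_trunc_admissible:
  assumes \<mu>: "Re \<mu> > 0" and w: "admissible w"
  shows "log_negligible (\<lambda>M. zeta_trunc_word \<mu> M w - zeta_mu \<mu> w)"
proof (cases w rule: rev_cases)
  case Nil
  have "sorted_tuples 0 = {[]}" by (auto simp: sorted_tuples_def)
  with Nil show ?thesis by (simp add: zeta_mu_def denom_def)
next
  case (snoc u x)
  with w have u: "positive u" and x: "fst x \<ge> 2" "snd x > 0"
    by (auto simp: admissible_def positive_singleton letters_def)
  obtain D where D: "\<And>n. norm (letter_fun \<mu> x n) \<le> D / (real n + 1)\<^sup>2"
    using letter_fun_bound[OF \<mu> x(2,1)] by blast
  have "zeta_mu \<mu> w = (\<Sum>\<^sub>\<infinity>ns\<in>sorted_tuples (Suc (length u)).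
      \<Prod>i<Suc (length u). ((map (letter_fun \<mu>) u @ [letter_fun \<mu> x]) ! i) (ns ! i))"
    using prod_letter_fun[of \<mu> w] unfolding zeta_mu_def by (simp add: snoc del: prod.lessThan_Suc)
  with nested_sum_log_negligible_tail[of "map (letter_fun \<mu>) u", OF letter_fun_bound_word[OF \<mu> u] D]
  show ?thesis by (simp add: zeta_trunc_word_nested_sum snoc del: prod.lessThan_Suc)
qed

text \<open>The two last letters agree to first order in 1 / n, so their divergent contributions
  cancel and a weight of size 1 / n^2 remains.\<close>

lemma zeta_trunc_special:
  assumes \<mu>: "Re \<mu> > 0" and s: "special u m m'"
  shows "log_negligible (\<lambda>M. zeta_trunc_word \<mu> M (u @ [(1, m)]) - zeta_trunc_word \<mu> M (u @ [(1, m')]) - D_mu \<mu> u m m')"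
proof -
  have u: "positive u" and m: "m > 0" "m' > 0" using s by (auto simp: special_def)
  \<comment> \<open>The product of two letter functions has two factors \<mu>; the series of
    \<open>D_mu\<close> has one for its last index, hence the division.\<close>
  define t where "t n = letter_fun \<mu> (1, m) n * letter_fun \<mu> (1, m') n / \<mu>" for n
  have \<mu>0: "\<mu> \<noteq> 0" using \<mu> by auto
  obtain C where C: "\<And>n. norm (letter_fun \<mu> (1, m) n) \<le> C / (real n + 1)"
    using letter_fun_bound[OF \<mu>, of "(1, m)" 1] m by auto
  obtain C' where C': "\<And>n. norm (letter_fun \<mu> (1, m') n) \<le> C' / (real n + 1)"
    using letter_fun_bound[OF \<mu>, of "(1, m')" 1] m by auto
  have t: "norm (t n) \<le> (C * C' / norm \<mu>) / (real n + 1)\<^sup>2" for n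
  proof -
    have "norm (letter_fun \<mu> (1, m) n) * norm (letter_fun \<mu> (1, m') n) \<le> (C / (real n + 1)) * (C' / (real n + 1))"
      using C[of n] C'[of n] by (intro mult_mono) (auto intro: order_trans[OF norm_ge_zero])
    from divide_right_mono[OF this, of "norm \<mu>"] show ?thesis
      by (simp add: t_def norm_divide norm_mult power2_eq_square mult_ac)
  qed
  have t_eq: "t n = \<mu> / ((of_nat n * \<mu> + of_rat m) * (of_nat n * \<mu> + of_rat m'))" for n
    using \<mu>0 by (simp add: t_def letter_fun_def)
  have diff: "letter_fun \<mu> (1, m) n - letter_fun \<mu> (1, m') n = of_rat (m' - m) * t n" for n
    using nonzero_denominator[OF \<mu> m(1), of n] nonzero_denominator[OF \<mu> m(2), of n]
    by (simp add: t_eq letter_fun_def of_rat_diff field_simps)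
  have "(\<Prod>i<Suc (length u). ((map (letter_fun \<mu>) u @ [t]) ! i) (ns ! i))
      = \<mu> ^ (length u + 1) / (denom \<mu> u ns * (of_nat (ns ! length u) * \<mu> + of_rat m)
          * (of_nat (ns ! length u) * \<mu> + of_rat m'))" for ns
    using prod_letter_fun[of \<mu> u ns] by (simp add: nth_append t_eq mult_ac)
  then have D: "D_mu \<mu> u m m' = of_rat (m' - m) * (\<Sum>\<^sub>\<infinity>ns\<in>sorted_tuples (Suc (length u)).
      \<Prod>i<Suc (length u). ((map (letter_fun \<mu>) u @ [t]) ! i) (ns ! i))"
    by (simp only: D_mu_def Suc_eq_plus1)
  have "zeta_trunc_word \<mu> M (u @ [(1, m)]) - zeta_trunc_word \<mu> M (u @ [(1, m')])
      = of_rat (m' - m) * nested_sum (map (letter_fun \<mu>) u @ [t]) M" for M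
    unfolding zeta_trunc_word_snoc nested_sum_snoc sum_subtractf[symmetric] right_diff_distrib[symmetric] diff
    by (simp add: zeta_trunc_word_nested_sum sum_distrib_left mult_ac)
  with log_negligible_mult[OF nested_sum_log_negligible_tail[of "map (letter_fun \<mu>) u",
        OF letter_fun_bound_word[OF \<mu> u] t] log_bounded_const[of "of_rat (m' - m)"]]
  show ?thesis by (simp add: D right_diff_distrib del: prod.lessThan_Suc)
qed

section \<open>Limits on the quasi-admissible part\<close>

lemma Qsubmodule_Z_mu: "Qsubmodule \<mu> (*) (Z_mu \<mu>)"
  unfolding Z_mu_def by (rule Qsubmodule_span_over[OF module_complex])

text \<open>The limit is asserted to exist instead of being named \<open>zeta_star\<close>: as
  \<open>lim\<close> is additive only on convergent sequences, the existential form is the one that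
  passes directly from generators to their span.\<close>

lemma zeta_trunc_free_alg0:
  assumes \<mu>: "Re \<mu> > 0" and p: "p \<in> free_alg0 \<mu>"
  shows "\<exists>c\<in>Z_mu \<mu>. log_negligible (\<lambda>M. zeta_trunc \<mu> M p - c)"
proof -
  have "free_alg0 \<mu> \<subseteq> {p. \<exists>c\<in>Z_mu \<mu>. log_negligible (\<lambda>M. zeta_trunc \<mu> M p - c)}" (is "_ \<subseteq> ?A")
  proof (rule free_alg0_subset)
    show "Qsubmodule \<mu> nc_scale ?A"
    proof (rule QsubmoduleI)
      show "0 \<in> ?A" by (auto intro!: bexI[of _ 0] Qsubmodule_zero[OF Qsubmodule_Z_mu])
      fix p q assume "p \<in> ?A" "q \<in> ?A"
      then obtain c d where *: "c \<in> Z_mu \<mu>" "d \<in> Z_mu \<mu>"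
        "log_negligible (\<lambda>M. zeta_trunc \<mu> M p - c)" "log_negligible (\<lambda>M. zeta_trunc \<mu> M q - d)" by blast
      from log_negligible_add[OF *(3,4)] have "log_negligible (\<lambda>M. zeta_trunc \<mu> M (p + q) - (c + d))"
        by (simp add: zeta_trunc.add algebra_simps)
      with * show "p + q \<in> ?A" by (auto intro!: bexI[of _ "c + d"] Qsubmodule_add[OF Qsubmodule_Z_mu])
    next
      fix r p assume r: "r \<in> Qring \<mu>" and "p \<in> ?A"
      then obtain c where *: "c \<in> Z_mu \<mu>" "log_negligible (\<lambda>M. zeta_trunc \<mu> M p - c)" by blast
      from log_negligible_mult[OF *(2), of "\<lambda>_. r"] have "log_negligible (\<lambda>M. zeta_trunc \<mu> M (nc_scale r p) - r * c)"
        by (simp add: zeta_trunc.scale algebra_simps)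
      with * r show "nc_scale r p \<in> ?A"
        by (auto intro!: bexI[of _ "r * c"] Qsubmodule_scale[OF Qsubmodule_Z_mu])
    qed
  next
    fix w assume "admissible w"
    with zeta_trunc_admissible[OF \<mu> this] show "wd w \<in> ?A"
      unfolding Z_mu_def by (auto intro!: bexI[of _ "zeta_mu \<mu> w"] span_over_base[OF module_complex])
  next
    fix u m m' assume "special u m m'"
    with zeta_trunc_special[OF \<mu> this] show "wd (u @ [(1, m)]) - wd (u @ [(1, m')]) \<in> ?A"
      unfolding Z_mu_def
      by (auto intro!: bexI[of _ "D_mu \<mu> u m m'"] span_over_base[OF module_complex]
          simp: zeta_trunc.diff simp del: One_nat_def)
  qed
  with p show ?thesis by blast
qed

lemma zeta_star_free_alg0:
  assumes "Re \<mu> > 0" "p \<in> free_alg0 \<mu>"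
  shows "zeta_star \<mu> p \<in> Z_mu \<mu>" "log_negligible (\<lambda>M. zeta_trunc \<mu> M p - zeta_star \<mu> p)"
proof -
  obtain c where c: "c \<in> Z_mu \<mu>" "log_negligible (\<lambda>M. zeta_trunc \<mu> M p - c)"
    using zeta_trunc_free_alg0[OF assms] by blast
  from log_negligible_imp_tendsto[OF c(2)] have "(\<lambda>M. zeta_trunc \<mu> M p) \<longlonglongrightarrow> c"
    by (simp add: LIM_zero_cancel)
  then have "zeta_star \<mu> p = c" unfolding zeta_star_def by (rule limI)
  with c show "zeta_star \<mu> p \<in> Z_mu \<mu>" "log_negligible (\<lambda>M. zeta_trunc \<mu> M p - zeta_star \<mu> p)" by simp_all
qed

text \<open>With z = n \<mu> + m, the real part of \<mu> / z is (n |\<mu>|^2 + m Re \<mu>) / |z|^2,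
  whose numerator grows at least like n and whose denominator at most like n^2. Bounding the real
  part, not the norm, excludes cancellation in the sum over n and gives harmonic divergence.\<close>

lemma Re_letter_fun_lower_bound:
  assumes \<mu>: "Re \<mu> > 0" and m: "m > 0"
  shows "\<exists>c>0. \<forall>n. c / (real n + 1) \<le> Re (letter_fun \<mu> (1, m) n)"
proof -
  define c C where "c = min ((cmod \<mu>)\<^sup>2) (of_rat m * Re \<mu>)" and "C = cmod \<mu> + of_rat m"
  have c: "c > 0" using \<mu> m by (auto simp: c_def)
  have C: "C > 0" using m by (simp add: C_def add_nonneg_pos)
  have "c / C\<^sup>2 / (real n + 1) \<le> Re (letter_fun \<mu> (1, m) n)" for n
  proof -
    let ?z = "of_nat n * \<mu> + of_rat m"
    have z: "?z \<noteq> 0" by (rule nonzero_denominator[OF \<mu> m])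
    have "cmod ?z \<le> real n * cmod \<mu> + of_rat m"
      by (rule order_trans[OF norm_triangle_ineq]) (use m in \<open>simp add: norm_mult complex_of_rat_eq\<close>)
    also have "\<dots> \<le> C * (real n + 1)" using m by (simp add: C_def algebra_simps)
    finally have "(cmod ?z)\<^sup>2 \<le> (C * (real n + 1))\<^sup>2" by (intro power_mono) auto
    moreover have "c * (real n + 1) \<le> Re (\<mu> * cnj ?z)"
    proof -
      have "c * (real n + 1) = real n * c + c" by (simp add: algebra_simps)
      also have "\<dots> \<le> real n * (cmod \<mu>)\<^sup>2 + of_rat m * Re \<mu>"
        unfolding c_def by (intro add_mono mult_left_mono) auto
      also have "\<dots> = Re (\<mu> * cnj ?z)"
        unfolding cmod_power2 by (simp add: complex_of_rat_eq algebra_simps power2_eq_square)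
      finally show ?thesis .
    qed
    moreover have "(cmod ?z)\<^sup>2 > 0" using z by simp
    moreover have "0 \<le> c * (real n + 1)" using c by simp
    ultimately have "c * (real n + 1) / (C * (real n + 1))\<^sup>2 \<le> Re (\<mu> * cnj ?z) / (cmod ?z)\<^sup>2"
      by (intro frac_le) auto
    also have "\<dots> = Re (letter_fun \<mu> (1, m) n)"
      unfolding letter_fun_def by (subst complex_div_cnj) (simp del: complex_cnj_add complex_cnj_mult flip: of_real_power)
    also have "c * (real n + 1) / (C * (real n + 1))\<^sup>2 = c / C\<^sup>2 / (real n + 1)"
      by (simp add: power2_eq_square)
    finally show ?thesis .
  qed
  with c C show ?thesis by (intro exI[of _ "c / C\<^sup>2"]) auto
qed

lemma zeta_trunc_letter_at_infinity:
  assumes \<mu>: "Re \<mu> > 0" and m: "m > 0"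
  shows "filterlim (\<lambda>M. zeta_trunc_word \<mu> M [(1, m)]) at_infinity sequentially"
proof -
  obtain c where c: "c > 0" "\<And>n. c / (real n + 1) \<le> Re (letter_fun \<mu> (1, m) n)"
    using Re_letter_fun_lower_bound[OF assms] by blast
  have le: "c * harm (Suc M) \<le> norm (zeta_trunc_word \<mu> M [(1, m)])" for M
  proof -
    have "c * harm (Suc M) = (\<Sum>n\<le>M. c / (real n + 1))"
      unfolding harm_def One_nat_def sum.atLeast_Suc_atMost_Suc_shift
      by (simp add: sum_distrib_left atLeast0AtMost divide_inverse add.commute)
    also have "\<dots> \<le> (\<Sum>n\<le>M. Re (letter_fun \<mu> (1, m) n))" by (intro sum_mono c)
    also have "\<dots> = Re (zeta_trunc_word \<mu> M [(1, m)])"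
      using zeta_trunc_word_snoc[of \<mu> M "[]" "(1, m)"] by simp
    finally show ?thesis using complex_Re_le_cmod order_trans by blast
  qed
  have "filterlim (\<lambda>M. c * harm (Suc M)) at_top sequentially"
    by (rule filterlim_tendsto_pos_mult_at_top[OF tendsto_const c(1)])
       (rule filterlim_compose[OF harm_at_top filterlim_Suc])
  then have "filterlim (\<lambda>M. norm (zeta_trunc_word \<mu> M [(1, m)])) at_top sequentially"
    by (rule filterlim_at_top_mono) (intro always_eventually allI le)
  then show ?thesis by (rule filterlim_norm_at_top_imp_at_infinity)
qed

text \<open>Divided by the power of h of degree \<open>degree R\<close>, the values tend to the
  leading coefficient, but by hypothesis also to 0.\<close>

lemma poly_tendsto_0_at_infinity_imp_zero:
  fixes R :: "complex poly"
  assumes h: "filterlim h at_infinity F" and F: "F \<noteq> bot" and lim: "((\<lambda>x. poly R (h x)) \<longlongrightarrow> 0) F"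
  shows "R = 0"
proof -
  have "((\<lambda>x. poly R (h x) * inverse (h x) ^ degree R) \<longlongrightarrow> 0 * 0 ^ degree R) F"
    by (intro tendsto_mult tendsto_power lim filterlim_compose[OF tendsto_inverse_0 h])
  moreover have "((\<lambda>x. poly R (h x) / h x ^ degree R) \<longlongrightarrow> lead_coeff R) F"
    by (rule filterlim_compose[OF poly_divide_tendsto_aux h])
  ultimately have "lead_coeff R = 0"
    using tendsto_unique[OF F] by (fastforce simp: divide_inverse power_inverse)
  then show ?thesis by simp
qed

text \<open>The expansion is in the truncation H_M itself and not in log M, so the letter y
  corresponds to T without any error.\<close>

definition asymp_poly :: "complex \<Rightarrow> rat \<Rightarrow> ncpoly \<Rightarrow> complex poly \<Rightarrow> bool" where
  "asymp_poly \<mu> m p P \<longleftrightarrow>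
     log_negligible (\<lambda>M. zeta_trunc \<mu> M p - poly P (zeta_trunc_word \<mu> M [(1, m)]))"

lemma asymp_poly_unique:
  assumes "Re \<mu> > 0" "m > 0" "asymp_poly \<mu> m p P" "asymp_poly \<mu> m p Q"
  shows "P = Q"
proof -
  have "log_negligible (\<lambda>M. poly (P - Q) (zeta_trunc_word \<mu> M [(1, m)]))"
    using log_negligible_add[OF assms(4)[unfolded asymp_poly_def]
        log_negligible_uminus[OF assms(3)[unfolded asymp_poly_def]]] by simp
  from log_negligible_imp_tendsto[OF this] have "P - Q = 0"
    by (rule poly_tendsto_0_at_infinity_imp_zero[OF zeta_trunc_letter_at_infinity[OF assms(1,2)] sequentially_bot])
  then show ?thesis by simp
qed

lemma asymp_poly_add:
  assumes "asymp_poly \<mu> m p P" "asymp_poly \<mu> m q Q"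
  shows "asymp_poly \<mu> m (p + q) (P + Q)"
  using log_negligible_add[OF assms[unfolded asymp_poly_def]]
  by (simp add: asymp_poly_def zeta_trunc.add algebra_simps)

lemma asymp_poly_scale:
  assumes "asymp_poly \<mu> m p P"
  shows "asymp_poly \<mu> m (nc_scale c p) (smult c P)"
  using log_negligible_mult[OF assms[unfolded asymp_poly_def], of "\<lambda>_. c"]
  by (simp add: asymp_poly_def zeta_trunc.scale algebra_simps)

lemma asymp_poly_letter: "asymp_poly \<mu> m (wd [(1, m)]) [:0, 1:]"
  by (simp add: asymp_poly_def)

lemma asymp_poly_stuffle:
  assumes \<mu>: "Re \<mu> > 0" and m: "m > 0" and pq: "p \<in> free_alg \<mu>" "q \<in> free_alg \<mu>"
    and P: "asymp_poly \<mu> m p P" and Q: "asymp_poly \<mu> m q Q"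
  shows "asymp_poly \<mu> m (stuffle \<mu> p q) (P * Q)"
proof -
  let ?H = "\<lambda>M. zeta_trunc_word \<mu> M [(1, m)]"
  let ?e = "\<lambda>M. zeta_trunc \<mu> M p - poly P (?H M)" and ?d = "\<lambda>M. zeta_trunc \<mu> M q - poly Q (?H M)"
  have H: "log_bounded ?H"
    using m by (intro log_bounded_zeta_trunc_word \<mu>) (simp add: positive_singleton letters_def)
  have e: "log_negligible ?e" and d: "log_negligible ?d" using P Q by (simp_all add: asymp_poly_def)
  \<comment> \<open>This is (P + e)(Q + d) - P Q = Q e + (P + e) d: each error is multiplied by a
    factor of at most logarithmic power growth.\<close>
  have "log_negligible (\<lambda>M. poly Q (?H M) * ?e M + (poly P (?H M) + ?e M) * ?d M)"
    by (intro log_negligible_add log_negligible_mult e d log_bounded_add log_bounded_poly H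
        log_negligible_imp_log_bounded[OF e])
  then show ?thesis
    by (simp add: asymp_poly_def zeta_trunc_stuffle[OF \<mu> pq] algebra_simps)
qed

lemma asymp_poly_free_alg0:
  assumes "Re \<mu> > 0" "p \<in> free_alg0 \<mu>"
  shows "asymp_poly \<mu> m p [:zeta_star \<mu> p:]"
  using zeta_star_free_alg0(2)[OF assms] by (simp add: asymp_poly_def)

lemma stuffle_gen_subset_free_alg:
  assumes "m > 0" "p \<in> stuffle_gen \<mu> m"
  shows "p \<in> free_alg \<mu>"
  using assms(2)
proof induction
  case (base p)
  then show ?case using free_alg0_subset_free_alg by blast
next
  case (add p q)
  then show ?case by (intro Qsubmodule_add[OF Qsubmodule_free_alg])
next
  case (stuffle p)
  then show ?case using assms(1)
    by (intro stuffle_in_free_alg wd_in_free_alg) (auto simp: positive_singleton letters_def)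
qed

text \<open>Quasi-admissible elements give constants, and stuffling with y multiplies by T, which
  shifts the coefficients; so none leaves \<open>Z_mu\<close>.\<close>

lemma asymp_poly_exists:
  assumes \<mu>: "Re \<mu> > 0" and m: "m > 0" and p: "p \<in> free_alg \<mu>"
  shows "\<exists>P\<in>poly_over (Z_mu \<mu>). asymp_poly \<mu> m p P"
proof -
  have "p \<in> stuffle_gen \<mu> m" using free_alg_subset_stuffle_gen[OF m] p by blast
  then show ?thesis
  proof induction
    case (base p)
    have "[:zeta_star \<mu> p:] \<in> poly_over (Z_mu \<mu>)"
      using zeta_star_free_alg0(1)[OF \<mu> base] Qsubmodule_zero[OF Qsubmodule_Z_mu]
      by (simp add: poly_over_def coeff_pCons split: nat.split)
    with asymp_poly_free_alg0[OF \<mu> base] show ?case by blast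
  next
    case (add p q)
    then obtain P Q where "P \<in> poly_over (Z_mu \<mu>)" "Q \<in> poly_over (Z_mu \<mu>)"
      "asymp_poly \<mu> m p P" "asymp_poly \<mu> m q Q" by blast
    then show ?case
      by (intro bexI[of _ "P + Q"] asymp_poly_add) (auto simp: poly_over_def Qsubmodule_add[OF Qsubmodule_Z_mu])
  next
    case (stuffle p)
    then obtain P where P: "P \<in> poly_over (Z_mu \<mu>)" "asymp_poly \<mu> m p P" by blast
    have "asymp_poly \<mu> m (stuffle \<mu> p (wd [(1, m)])) (P * [:0, 1:])"
      using m by (intro asymp_poly_stuffle \<mu> P(2) stuffle_gen_subset_free_alg[OF m stuffle.hyps] asymp_poly_letter
          wd_in_free_alg) (auto simp: positive_singleton letters_def)
    moreover have "P * [:0, 1:] \<in> poly_over (Z_mu \<mu>)"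
      using P(1) Qsubmodule_zero[OF Qsubmodule_Z_mu]
      by (simp add: poly_over_def coeff_pCons split: nat.split)
    ultimately show ?case by blast
  qed
qed

theorem theorem1p3:
  fixes \<mu> :: complex and m :: rat
  assumes "Re \<mu> > 0" and "m > 0"
  shows "\<exists>!f. f \<in> free_alg \<mu> \<rightarrow>\<^sub>E poly_over (Z_mu \<mu>) \<and>
              Q_linear_on \<mu> (free_alg \<mu>) f \<and>
              (\<forall>w\<in>free_alg0 \<mu>. f w = [:zeta_star \<mu> w:]) \<and>
              f (wd [(1, m)]) = [:0, 1:] \<and>
              (\<forall>v\<in>free_alg \<mu>. \<forall>w\<in>free_alg \<mu>. f (stuffle \<mu> v w) = f v * f w)"
  (is "\<exists>!f. ?Q f")
proof -
  have y: "wd [(1, m)] \<in> free_alg \<mu>"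
    using assms(2) by (intro wd_in_free_alg) (simp add: positive_singleton letters_def)
  have "\<forall>p\<in>free_alg \<mu>. \<exists>P. P \<in> poly_over (Z_mu \<mu>) \<and> asymp_poly \<mu> m p P"
    using asymp_poly_exists[OF assms] by blast
  then obtain g where g: "\<And>p. p \<in> free_alg \<mu> \<Longrightarrow> g p \<in> poly_over (Z_mu \<mu>)"
    "\<And>p. p \<in> free_alg \<mu> \<Longrightarrow> asymp_poly \<mu> m p (g p)"
    by metis
  \<comment> \<open>By uniqueness, each required property of the chosen map reduces to exhibiting
    one asymptotic polynomial.\<close>
  have g_eq: "g p = P" if "p \<in> free_alg \<mu>" "asymp_poly \<mu> m p P" for p P
    using asymp_poly_unique[OF assms g(2)[OF that(1)] that(2)] .
  \<comment> \<open>Restriction fixes the value off the carrier, as the extensional function space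
    demands.\<close>
  define f where "f = restrict g (free_alg \<mu>)"
  have f: "f p = g p" if "p \<in> free_alg \<mu>" for p using that by (simp add: f_def)
  note closed = Qsubmodule_add[OF Qsubmodule_free_alg] Qsubmodule_scale[OF Qsubmodule_free_alg] stuffle_in_free_alg
  have Qf: "?Q f"
  proof (intro conjI ballI)
    show "f \<in> free_alg \<mu> \<rightarrow>\<^sub>E poly_over (Z_mu \<mu>)" using g(1) by (auto simp: f_def)
    show "Q_linear_on \<mu> (free_alg \<mu>) f"
      by (auto simp: Q_linear_on_def f closed intro!: g_eq closed asymp_poly_add asymp_poly_scale g(2))
    show "f (wd [(1, m)]) = [:0, 1:]" using g_eq[OF y asymp_poly_letter] y by (simp only: f)
    show "f w = [:zeta_star \<mu> w:]" if "w \<in> free_alg0 \<mu>" for w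
    proof -
      have "w \<in> free_alg \<mu>" using that free_alg0_subset_free_alg by blast
      with that show ?thesis by (simp add: f g_eq asymp_poly_free_alg0[OF assms(1)])
    qed
    show "f (stuffle \<mu> v w) = f v * f w" if "v \<in> free_alg \<mu>" "w \<in> free_alg \<mu>" for v w
      using that by (simp add: f closed) (intro g_eq closed asymp_poly_stuffle[OF assms] g(2))
  qed
  \<comment> \<open>Agreement spreads along \<open>stuffle_gen\<close>: property (i) settles the
    base, additivity the sums, and (ii) with (iii) the stuffling step.\<close>
  have unique: "f1 = f2" if "?Q f1" "?Q f2" for f1 f2
  proof (rule extensionalityI)
    show "f1 \<in> extensional (free_alg \<mu>)" "f2 \<in> extensional (free_alg \<mu>)"
      using that by (auto simp: PiE_def)
    fix p assume "p \<in> free_alg \<mu>"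
    then have "p \<in> stuffle_gen \<mu> m" using free_alg_subset_stuffle_gen[OF assms(2)] by blast
    then show "f1 p = f2 p"
    proof induction
      case (base p)
      then show ?case using that by simp
    next
      case (add p q)
      with stuffle_gen_subset_free_alg[OF assms(2)] that show ?case by (simp add: Q_linear_on_def)
    next
      case (stuffle p)
      with stuffle_gen_subset_free_alg[OF assms(2)] y that show ?case by simp
    qed
  qed
  show ?thesis
  proof (rule ex1I[where a = f])
    show "?Q f" by (rule Qf)
    show "f' = f" if "?Q f'" for f' using that Qf by (rule unique)
  qed
qed

end
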